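(* Let $n>1$, let $G=B_n$ be the simply connected compact group $Spin(2n+1)$, let $m$ be a positive integer and $p$ a prime. Write $m=p^i m'$ with $p\nmid m'$. (1) If $p=2$, then $N(B_n,m,2)$ is the number of tuples $(b_1,\dots,b_n)\in\mathbb{Z}^n\cup(\mathbb{Z}+\frac12)^n$ such that $$b_1>\dots>b_n>0\quad\text{and}\quad p^i>b_1+b_2.$$ (2) If $p>2$, then $N(B_n,m,p)$ is the number of tuples $(b_1,\dots,b_n)\in\mathbb{Z}^n$ such that $$b_1>\dots>b_n>0,\quad p^i>b_1+b_2,\quad\text{and}\quad 2\mid(b_1+\dots+b_n).$$
   Context: Let $G$ be a simply connected simple compact Lie group with maximal torus $T$ and weight lattice $\Pi^*=\mathrm{Hom}(T,S^1)$. $\langle\cdot,\cdot\rangle$ is the unique Weyl-invariant inner product on $\Pi^*$ (extended to $\Pi^*\otimes\mathbb{R}$) with $\langle u,u\rangle=2$ for all long roots $u$ (in the simply laced case all roots are long). The fundamental Weyl chamber $V\subset\Pi^*\otimes\mathbb{R}$ is the set of points having non-negative inner product with all positive roots; $\theta$ is the highest root. The level $m$ fundamental alcove is $A=\{x\in V:\langle\theta,x\rangle\le m\}$. A level $m$ regular weight is an element of $\Pi^*$ in the interior of $A$. $N(G,m,p)$ denotes the number of level $m$ regular weights $a$ such that for every weight $w\in\Pi^*$ the denominator (in lowest terms) of the rational number $\langle w,a\rangle/m$ is a power $p^k$, $k\ge0$, of $p$. *)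

theory Defs
  imports "HOL-Analysis.Analysis" "HOL-Computational_Algebra.Primes"
begin

text \<open>
  The complex Clifford algebra on generators \<open>e 0, \<dots>, e (N - 1)\<close> with \<open>e i * e i = - 1\<close>.
  An element is the function giving its coefficients in the basis of monomials \<open>e A\<close>
  (\<open>A \<subseteq> {..<N}\<close>, factors in increasing order), and is zero on all other sets. The
  real Clifford algebra consists of the elements with real coefficients.
\<close>

type_synonym cliff = "nat set \<Rightarrow> complex"

text \<open>
  \<open>e A * e B = cl_sign A B * e (sym_diff A B)\<close>: sorting the factors contributes a sign for each
  pair \<open>a > b\<close>, cancelling equal neighbours a sign for each pair \<open>a = b\<close>.
\<close>

definition cl_sign :: "nat set \<Rightarrow> nat set \<Rightarrow> complex" where
  "cl_sign A B = (- 1) ^ card {(a, b). a \<in> A \<and> b \<in> B \<and> b \<le> a}"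

definition cl_mult :: "nat \<Rightarrow> cliff \<Rightarrow> cliff \<Rightarrow> cliff" where
  "cl_mult N x y = (\<lambda>C. \<Sum>A\<in>Pow {..<N}. \<Sum>B\<in>Pow {..<N}.
     if sym_diff A B = C then cl_sign A B * x A * y B else 0)"

definition cl_one :: cliff where
  "cl_one = (\<lambda>A. if A = {} then 1 else 0)"

definition cl_prod :: "nat \<Rightarrow> cliff list \<Rightarrow> cliff" where
  "cl_prod N xs = foldr (cl_mult N) xs cl_one"

definition cl_vec :: "nat \<Rightarrow> (nat \<Rightarrow> real) \<Rightarrow> cliff" where
  "cl_vec N v = (\<lambda>A. \<Sum>k<N. if A = {k} then complex_of_real (v k) else 0)"

text \<open>\<open>Spin(N)\<close>: the products of an even number of unit vectors of \<open>\<real>\<^sup>N\<close>.\<close>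

definition Spin :: "nat \<Rightarrow> cliff set" where
  "Spin N = {cl_prod N (map (cl_vec N) vs) | vs.
     even (length vs) \<and>
     (\<forall>v\<in>set vs. v \<in> topspace (Euclidean_space N) \<and> (\<Sum>k<N. (v k)\<^sup>2) = 1)}"

text \<open>The complexified Lie algebra of \<open>Spin(N)\<close>: the complex span of the \<open>e i * e j\<close>, \<open>i < j < N\<close>.\<close>

definition spin_Lie :: "nat \<Rightarrow> cliff set" where
  "spin_Lie N = {X. \<forall>A. X A \<noteq> 0 \<longrightarrow> A \<subseteq> {..<N} \<and> card A = 2}"

text \<open>
  The standard maximal torus \<open>T\<close> of \<open>Spin(2n+1)\<close> and the exponential parametrization
  \<open>torus_exp n\<close> of it by its Lie algebra \<open>\<real>\<^sup>n\<close>. The point with parameter \<open>t\<close> covers the rotation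
  by the angles \<open>t j\<close> in the coordinate planes \<open>(2j, 2j+1)\<close>, hence the half angles.
\<close>

definition torus_factor :: "nat \<Rightarrow> real \<Rightarrow> cliff" where
  "torus_factor j s = (\<lambda>A. if A = {} then complex_of_real (cos (s / 2))
     else if A = {2 * j, 2 * j + 1} then complex_of_real (sin (s / 2)) else 0)"

definition torus_exp :: "nat \<Rightarrow> (nat \<Rightarrow> real) \<Rightarrow> cliff" where
  "torus_exp n t = cl_prod (2 * n + 1) (map (\<lambda>j. torus_factor j (t j)) [0..<n])"

definition max_torus :: "nat \<Rightarrow> cliff set" where
  "max_torus n = torus_exp n ` topspace (Euclidean_space n)"

text \<open>
  \<open>Hom(T, S\<^sup>1)\<close>: continuous homomorphisms, for the coefficientwise topology on the
  Clifford algebra.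
\<close>

definition torus_characters :: "nat \<Rightarrow> (cliff \<Rightarrow> complex) set" where
  "torus_characters n = {f. continuous_on (max_torus n) f \<and>
     (\<forall>x\<in>max_torus n. norm (f x) = 1) \<and>
     (\<forall>x\<in>max_torus n. \<forall>y\<in>max_torus n. f (cl_mult (2 * n + 1) x y) = f x * f y)}"

definition pairing :: "nat \<Rightarrow> (nat \<Rightarrow> real) \<Rightarrow> (nat \<Rightarrow> real) \<Rightarrow> real" where
  "pairing n l t = (\<Sum>j<n. l j * t j)"

text \<open>
  A character is identified with its differential, a linear form on the Lie algebra \<open>\<real>\<^sup>n\<close> of
  \<open>T\<close> given by its coefficients. This identifies \<open>Hom(T, S\<^sup>1) \<otimes> \<real>\<close> with \<open>\<real>\<^sup>n\<close>,
  i.e. with the topological space \<open>Euclidean_space n\<close>.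
\<close>

definition weight_lattice :: "nat \<Rightarrow> (nat \<Rightarrow> real) set" where
  "weight_lattice n = {l \<in> topspace (Euclidean_space n). \<exists>f\<in>torus_characters n.
     \<forall>t\<in>topspace (Euclidean_space n). f (torus_exp n t) = cis (pairing n l t)}"

text \<open>
  Roots: nonzero weights of the adjoint action \<open>X \<mapsto> g X g\<^sup>-\<^sup>1\<close> of \<open>T\<close> on the complexified Lie
  algebra; the eigenvector equation is multiplied by \<open>g = torus_exp n t\<close> from the right.
\<close>

definition roots :: "nat \<Rightarrow> (nat \<Rightarrow> real) set" where
  "roots n = {u \<in> topspace (Euclidean_space n). u \<noteq> (\<lambda>_. 0) \<and>
     (\<exists>X\<in>spin_Lie (2 * n + 1). X \<noteq> (\<lambda>_. 0) \<and>
       (\<forall>t\<in>topspace (Euclidean_space n).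
          cl_mult (2 * n + 1) (torus_exp n t) X =
          (\<lambda>A. cis (pairing n u t) * cl_mult (2 * n + 1) X (torus_exp n t) A)))}"

text \<open>
  The Weyl group \<open>N(T)/T\<close>, as the group of matrices by which it acts on the Lie algebra of
  \<open>T\<close>: those \<open>w\<close> with \<open>g exp(t) g\<^sup>-\<^sup>1 = exp(w t)\<close> for some \<open>g\<close> in the group. On linear
  forms it acts by composition with \<open>w\<close>, i.e. by the transposed matrix.
\<close>

definition weyl_group :: "nat \<Rightarrow> (nat \<Rightarrow> nat \<Rightarrow> real) set" where
  "weyl_group n = {w. \<exists>g\<in>Spin (2 * n + 1). \<forall>t\<in>topspace (Euclidean_space n).
     cl_mult (2 * n + 1) g (torus_exp n t) =
     cl_mult (2 * n + 1) (torus_exp n (\<lambda>j. if j < n then \<Sum>k<n. w j k * t k else 0)) g}"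

definition weyl_act :: "nat \<Rightarrow> (nat \<Rightarrow> nat \<Rightarrow> real) \<Rightarrow> (nat \<Rightarrow> real) \<Rightarrow> nat \<Rightarrow> real" where
  "weyl_act n w l = (\<lambda>k. if k < n then \<Sum>j<n. l j * w j k else 0)"

definition is_inner_product :: "nat \<Rightarrow> ((nat \<Rightarrow> real) \<Rightarrow> (nat \<Rightarrow> real) \<Rightarrow> real) \<Rightarrow> bool" where
  "is_inner_product n ip \<longleftrightarrow>
     (\<forall>x\<in>topspace (Euclidean_space n). \<forall>y\<in>topspace (Euclidean_space n). ip x y = ip y x) \<and>
     (\<forall>x\<in>topspace (Euclidean_space n). \<forall>y\<in>topspace (Euclidean_space n).
        \<forall>z\<in>topspace (Euclidean_space n). \<forall>a b.
          ip (\<lambda>j. a * x j + b * y j) z = a * ip x z + b * ip y z) \<and>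
     (\<forall>x\<in>topspace (Euclidean_space n). x \<noteq> (\<lambda>_. 0) \<longrightarrow> ip x x > 0)"

definition is_basic_inner_product ::
  "nat \<Rightarrow> ((nat \<Rightarrow> real) \<Rightarrow> (nat \<Rightarrow> real) \<Rightarrow> real) \<Rightarrow> bool" where
  "is_basic_inner_product n ip \<longleftrightarrow> is_inner_product n ip \<and>
     (\<forall>w\<in>weyl_group n. \<forall>x\<in>topspace (Euclidean_space n). \<forall>y\<in>topspace (Euclidean_space n).
        ip (weyl_act n w x) (weyl_act n w y) = ip x y) \<and>
     (\<forall>u\<in>roots n. (\<forall>v\<in>roots n. ip v v \<le> ip u u) \<longrightarrow> ip u u = 2)"

text \<open>
  The basic inner product is unique only as a function on \<open>\<real>\<^sup>n\<close>; its values at arguments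
  outside \<open>topspace (Euclidean_space n)\<close> are arbitrary and never used.
\<close>

definition basic_ip :: "nat \<Rightarrow> (nat \<Rightarrow> real) \<Rightarrow> (nat \<Rightarrow> real) \<Rightarrow> real" where
  "basic_ip n = (SOME ip. is_basic_inner_product n ip)"

text \<open>The positive roots for the lexicographic order.\<close>

definition positive_roots :: "nat \<Rightarrow> (nat \<Rightarrow> real) set" where
  "positive_roots n = {u \<in> roots n. \<exists>k<n. u k > 0 \<and> (\<forall>j<k. u j = 0)}"

inductive_set positive_root_sums :: "nat \<Rightarrow> (nat \<Rightarrow> real) set" for n where
  zero: "(\<lambda>_. 0) \<in> positive_root_sums n"
| add: "x \<in> positive_root_sums n \<Longrightarrow> u \<in> positive_roots n \<Longrightarrow>
    (\<lambda>j. x j + u j) \<in> positive_root_sums n"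

definition highest_root :: "nat \<Rightarrow> nat \<Rightarrow> real" where
  "highest_root n = (THE h. h \<in> roots n \<and>
     (\<forall>u\<in>roots n. (\<lambda>j. h j - u j) \<in> positive_root_sums n))"

definition weyl_chamber :: "nat \<Rightarrow> (nat \<Rightarrow> real) set" where
  "weyl_chamber n = {x \<in> topspace (Euclidean_space n). \<forall>u\<in>positive_roots n. basic_ip n x u \<ge> 0}"

definition alcove :: "nat \<Rightarrow> nat \<Rightarrow> (nat \<Rightarrow> real) set" where
  "alcove n m = {x \<in> weyl_chamber n. basic_ip n (highest_root n) x \<le> real m}"

definition regular_weights :: "nat \<Rightarrow> nat \<Rightarrow> (nat \<Rightarrow> real) set" where
  "regular_weights n m = weight_lattice n \<inter> (Euclidean_space n interior_of alcove n m)"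

text \<open>
  The number \<open>N(B\<^sub>n, m, p)\<close>. The second component of \<open>quotient_of q\<close> is the denominator of
  \<open>q\<close> in lowest terms.
\<close>

definition N_B :: "nat \<Rightarrow> nat \<Rightarrow> nat \<Rightarrow> nat" where
  "N_B n m p = card {a \<in> regular_weights n m. \<forall>w\<in>weight_lattice n.
     \<exists>q::rat. real_of_rat q = basic_ip n w a / real m \<and>
       (\<exists>k::nat. snd (quotient_of q) = int p ^ k)}"

end

theory Submission
  imports Defs
begin

text \<open>
  In the coordinates of the standard torus the kernel of \<open>torus_exp\<close> is \<open>2 * pi\<close> times the vectors
  in \<open>\<int>\<^sup>n\<close> with even coordinate sum, so the weights are the vectors in \<open>\<int>\<^sup>n \<union> (\<int> + 1/2)\<^sup>n\<close>;
  the roots are the \<open>\<plusminus> e i\<close> and \<open>\<plusminus> e i \<plusminus> e j\<close>. The Weyl group acts by isometries of the standard inner product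
  because it preserves the trace of the spin representation, and since it contains all sign changes and
  transpositions, the basic inner product is the standard one. Hence the regular weights are the \<open>a\<close> with
  \<open>a 0 > \<dots> > a (n - 1) > 0\<close> and \<open>a 0 + a 1 < m\<close>. The denominator condition for the weights
  \<open>e j\<close> makes \<open>m'\<close> (for odd \<open>p\<close> even \<open>2 * m'\<close>) divide the integers \<open>2 * a j\<close>, and for odd \<open>p\<close> the
  weight \<open>(1/2, \<dots>, 1/2)\<close> makes the sum of the \<open>a j / m'\<close> even; so \<open>b = a / m'\<close> is the bijection.
\<close>

subsection \<open>The Clifford algebra\<close>

text \<open>Roots, characters and Weyl group elements are given only by the existence of Clifford
  elements that satisfy certain equations. The Weyl group is never determined: existence of the
  basic inner product needs an upper bound on it, uniqueness a lower one. For the upper bound the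
  coefficient at \<open>{}\<close> serves as the trace, since it is invariant under conjugation; for
  the lower bound, products of two unit vectors are exhibited. The primes 2 and p > 2 differ because
  two weights pair into quarter integers. The denominator 4 is a power of 2, so for p = 2 it does no
  harm and half-integral tuples survive. For odd p it has to be cleared: the vectors that pair
  integrally with all weights are the integral ones with even coordinate sum, which is the origin of
  the parity condition.\<close>

definition cl_basis :: "nat set \<Rightarrow> cliff" where
  "cl_basis A = (\<lambda>C. if C = A then 1 else 0)"

text \<open>\<open>cl_mult N\<close> discards all coefficients outside the subsets of
  \<open>{..<N}\<close>, so \<open>cl_one\<close> is a unit only for elements supported
  there.\<close>

definition cl_supp :: "nat \<Rightarrow> cliff \<Rightarrow> bool" where
  "cl_supp N x \<longleftrightarrow> (\<forall>C. x C \<noteq> 0 \<longrightarrow> C \<subseteq> {..<N})"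

text \<open>One sign per pair: in this form the behaviour of \<open>cl_sign\<close> in each argument
  is that of a product over a set.\<close>

lemma cl_sign_prod:
  assumes "finite A" "finite B"
  shows "cl_sign A B = (\<Prod>a\<in>A. \<Prod>b\<in>B. if b \<le> a then - 1 else 1)"
proof -
  have "{(a, b). a \<in> A \<and> b \<in> B \<and> b \<le> a} = Sigma A (\<lambda>a. {b\<in>B. b \<le> a})" by auto
  then have "card {(a, b). a \<in> A \<and> b \<in> B \<and> b \<le> a} = (\<Sum>a\<in>A. card {b\<in>B. b \<le> a})"
    using assms by simp
  moreover have "(\<Prod>b\<in>B. if b \<le> a then - 1 else 1 :: complex) = (- 1) ^ card {b\<in>B. b \<le> a}" for a
    using assms by (simp add: prod.If_cases Int_def)
  ultimately show ?thesis by (simp add: cl_sign_def power_sum)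
qed

text \<open>On the right the factors over the intersection occur twice and cancel.\<close>

lemma prod_sym_diff:
  fixes f :: "'a \<Rightarrow> complex"
  assumes "finite A" "finite B" and sq: "\<And>x. f x * f x = 1"
  shows "prod f (sym_diff A B) = prod f A * prod f B"
proof -
  have "prod f A = prod f (A - B) * prod f (A \<inter> B)"
    using assms by (metis Diff_disjoint Diff_Int2 Int_Diff_Un Int_commute finite_Diff finite_Int inf.idem prod.union_disjoint prod.Int_Diff mult.commute)
  moreover have "prod f B = prod f (B - A) * prod f (A \<inter> B)"
    using assms by (metis Int_commute prod.Int_Diff mult.commute)
  moreover have "prod f (A \<inter> B) * prod f (A \<inter> B) = 1"
    by (simp add: prod.distrib[symmetric] sq)
  moreover have "prod f (sym_diff A B) = prod f (A - B) * prod f (B - A)"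
    using assms by (intro prod.union_disjoint) auto
  ultimately show ?thesis by (simp add: algebra_simps)
qed

lemma prod_sign_sq: "(\<Prod>b\<in>B. if P b then - 1 else 1 :: complex) * (\<Prod>b\<in>B. if P b then - 1 else 1) = 1"
  by (simp add: prod.distrib[symmetric] if_distrib cong: if_cong)

text \<open>With the next lemma, \<open>cl_sign\<close> is multiplicative in each argument for the
  group law \<open>sym_diff\<close> on finite sets. This bicharacter property is what makes the
  Clifford product associative.\<close>

lemma cl_sign_sym_diff_left:
  assumes "finite A" "finite B" "finite C"
  shows "cl_sign (sym_diff A B) C = cl_sign A C * cl_sign B C"
  using assms by (simp only: cl_sign_prod finite_Un finite_Diff)
    (rule prod_sym_diff, auto simp: prod_sign_sq)

lemma cl_sign_sym_diff_right:
  assumes "finite A" "finite B" "finite C"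
  shows "cl_sign A (sym_diff B C) = cl_sign A B * cl_sign A C"
proof -
  have "(\<Prod>b\<in>sym_diff B C. if b \<le> a then - 1 else 1) =
    (\<Prod>b\<in>B. if b \<le> a then - 1 else 1) * (\<Prod>b\<in>C. if b \<le> a then - 1 else 1 :: complex)" for a
    by (rule prod_sym_diff) (use assms in auto)
  then show ?thesis using assms by (simp only: cl_sign_prod finite_Un finite_Diff prod.distrib simp_thms)
qed

lemma cl_sign_sq: "cl_sign A B * cl_sign A B = 1"
  by (simp add: cl_sign_def power_mult_distrib[symmetric])

text \<open>Of \<open>b \<le> a\<close> and \<open>a \<le> b\<close> exactly one holds when a and b
  differ, and both when they agree. So the two signs multiply to one factor -1 for each pair and one
  more for each common element.\<close>

lemma cl_sign_swap:
  assumes "finite A" "finite B"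
  shows "cl_sign A B = (- 1) ^ (card A * card B + card (A \<inter> B)) * cl_sign B A"
proof -
  have "(\<Prod>b\<in>B. if b \<le> a then - 1 else 1) * (\<Prod>b\<in>B. if a \<le> b then - 1 else 1) =
     (- 1) ^ card B * (if a \<in> B then - 1 else 1 :: complex)" for a
  proof -
    have "(\<Prod>b\<in>B. if b \<le> a then - 1 else 1) * (\<Prod>b\<in>B. if a \<le> b then - 1 else 1) =
      (\<Prod>b\<in>B. (- 1) * (if b = a then - 1 else 1 :: complex))"
      unfolding prod.distrib[symmetric] by (rule prod.cong) auto
    also have "\<dots> = (- 1) ^ card B * (\<Prod>b\<in>B. if b = a then - 1 else 1)"
      by (simp only: prod.distrib prod_constant)
    finally show ?thesis using assms by (simp add: prod.delta)
  qed
  moreover have "cl_sign B A = (\<Prod>a\<in>A. \<Prod>b\<in>B. if a \<le> b then - 1 else 1)"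
    using assms by (simp add: cl_sign_prod prod.swap[of _ B])
  ultimately have "cl_sign A B * cl_sign B A = (\<Prod>a\<in>A. (- 1) ^ card B * (if a \<in> B then - 1 else 1))"
    using assms by (simp add: cl_sign_prod prod.distrib[symmetric])
  also have "\<dots> = ((- 1) ^ card B) ^ card A * (\<Prod>a\<in>A. if a \<in> B then - 1 else 1)"
    by (simp only: prod.distrib prod_constant)
  also have "\<dots> = (- 1) ^ (card A * card B + card (A \<inter> B))"
    using assms by (simp add: prod.If_cases power_add mult.commute Int_def flip: power_mult)
  finally show ?thesis using cl_sign_sq[of B A]
    by (metis mult.assoc mult.right_neutral)
qed

text \<open>For given A and C the only B with \<open>sym_diff A B = C\<close> is
  \<open>sym_diff A C\<close>, so the inner sum collapses.\<close>

lemma cl_mult_coeff: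
  "cl_mult N x y C = (if C \<subseteq> {..<N} then \<Sum>A\<in>Pow {..<N}. cl_sign A (sym_diff A C) * x A * y (sym_diff A C) else 0)"
proof -
  have eq: "sym_diff A B = C \<longleftrightarrow> B = sym_diff A C" for A B by blast
  show ?thesis
  proof (cases "C \<subseteq> {..<N}")
    case True
    have "(\<Sum>B\<in>Pow {..<N}. if sym_diff A B = C then cl_sign A B * x A * y B else 0) =
      cl_sign A (sym_diff A C) * x A * y (sym_diff A C)" if "A \<in> Pow {..<N}" for A
    proof -
      have "sym_diff A C \<in> Pow {..<N}" using that True by auto
      then show ?thesis unfolding eq by (simp only: sum.delta finite_Pow_iff finite_lessThan if_True)
    qed
    then show ?thesis using True by (simp add: cl_mult_def)
  next
    case False
    have "(if sym_diff A B = C then cl_sign A B * x A * y B else 0) = 0"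
      if "A \<in> Pow {..<N}" "B \<in> Pow {..<N}" for A B
    proof -
      have "sym_diff A B \<noteq> C" using False that by auto
      then show ?thesis by simp
    qed
    then show ?thesis using False by (simp add: cl_mult_def)
  qed
qed

lemma finite_Pow_mem: "A \<in> Pow {..<N::nat} \<Longrightarrow> finite A"
  by (auto intro: finite_subset)

lemma sum_Pow_sym_diff:
  fixes f :: "nat set \<Rightarrow> complex"
  assumes "B \<subseteq> {..<N}"
  shows "(\<Sum>A\<in>Pow {..<N}. f (sym_diff B A)) = (\<Sum>A\<in>Pow {..<N}. f A)"
  by (rule sum.reindex_bij_witness[where i = "\<lambda>A. sym_diff B A" and j = "\<lambda>A. sym_diff B A"])
    (use assms in auto)

text \<open>Both sides are double sums over triples of sets with symmetric difference D. A
  reindexing matches the triples, and the bicharacter property of \<open>cl_sign\<close> matches the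
  signs.\<close>

lemma cl_mult_assoc: "cl_mult N (cl_mult N x y) z = cl_mult N x (cl_mult N y z)"
proof
  fix D
  show "cl_mult N (cl_mult N x y) z D = cl_mult N x (cl_mult N y z) D"
  proof (cases "D \<subseteq> {..<N}")
    case False
    then show ?thesis by (simp add: cl_mult_coeff)
  next
    case True
    let ?P = "Pow {..<N}"
    have fD: "finite D" using True by (auto intro: finite_subset)
    have "cl_mult N x (cl_mult N y z) D = (\<Sum>B\<in>?P. cl_sign B (sym_diff B D) * x B *
       (\<Sum>A\<in>?P. cl_sign A (sym_diff A (sym_diff B D)) * y A * z (sym_diff A (sym_diff B D))))"
    proof -
      have "sym_diff B D \<subseteq> {..<N}" if "B \<in> ?P" for B using that True by auto
      then show ?thesis unfolding cl_mult_coeff[of N x] cl_mult_coeff[of N y] using True by simp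
    qed
    also have "\<dots> = (\<Sum>B\<in>?P. \<Sum>A\<in>?P. cl_sign A (sym_diff A D) * (cl_sign B (sym_diff B A) * x B * y (sym_diff B A)) * z (sym_diff A D))"
    proof (rule sum.cong[OF refl])
      fix B assume B: "B \<in> ?P"
      \<comment> \<open>Replace A by \<open>sym_diff B A\<close>, so that A becomes the index of the
        product of x and y.\<close>
      have "(\<Sum>A\<in>?P. cl_sign A (sym_diff A (sym_diff B D)) * y A * z (sym_diff A (sym_diff B D))) =
        (\<Sum>A\<in>?P. cl_sign (sym_diff B A) (sym_diff (sym_diff B A) (sym_diff B D)) * y (sym_diff B A) * z (sym_diff (sym_diff B A) (sym_diff B D)))"
        by (rule sum_Pow_sym_diff[symmetric]) (use B in auto)
      also have "\<dots> = (\<Sum>A\<in>?P. cl_sign (sym_diff B A) (sym_diff A D) * y (sym_diff B A) * z (sym_diff A D))"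
      proof (rule sum.cong[OF refl])
        fix A
        have "sym_diff (sym_diff B A) (sym_diff B D) = sym_diff A D" by blast
        then show "cl_sign (sym_diff B A) (sym_diff (sym_diff B A) (sym_diff B D)) * y (sym_diff B A) * z (sym_diff (sym_diff B A) (sym_diff B D))
          = cl_sign (sym_diff B A) (sym_diff A D) * y (sym_diff B A) * z (sym_diff A D)" by (simp only:)
      qed
      finally have "cl_sign B (sym_diff B D) * x B * (\<Sum>A\<in>?P. cl_sign A (sym_diff A (sym_diff B D)) * y A * z (sym_diff A (sym_diff B D))) =
        (\<Sum>A\<in>?P. cl_sign B (sym_diff B D) * x B * (cl_sign (sym_diff B A) (sym_diff A D) * y (sym_diff B A) * z (sym_diff A D)))"
        by (simp only: sum_distrib_left)
      also have "\<dots> = (\<Sum>A\<in>?P. cl_sign A (sym_diff A D) * (cl_sign B (sym_diff B A) * x B * y (sym_diff B A)) * z (sym_diff A D))"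
      proof (rule sum.cong[OF refl])
        fix A assume A: "A \<in> ?P"
        have fin: "finite A" "finite B" using A B finite_Pow_mem by blast+
        have "sym_diff (sym_diff B D) (sym_diff A D) = sym_diff B A" by blast
        then have "cl_sign B (sym_diff B D) * cl_sign B (sym_diff A D) = cl_sign B (sym_diff B A)"
          by (subst cl_sign_sym_diff_right[symmetric]) (use fin fD in \<open>auto simp only: finite_Un finite_Diff\<close>)
        moreover have "cl_sign (sym_diff B A) (sym_diff A D) = cl_sign B (sym_diff A D) * cl_sign A (sym_diff A D)"
          by (rule cl_sign_sym_diff_left) (use fin fD in \<open>simp_all only: finite_Un finite_Diff simp_thms\<close>)
        ultimately show "cl_sign B (sym_diff B D) * x B * (cl_sign (sym_diff B A) (sym_diff A D) * y (sym_diff B A) * z (sym_diff A D)) =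
          cl_sign A (sym_diff A D) * (cl_sign B (sym_diff B A) * x B * y (sym_diff B A)) * z (sym_diff A D)"
          by (simp only: mult.assoc mult.left_commute flip: \<open>cl_sign B (sym_diff B D) * cl_sign B (sym_diff A D) = cl_sign B (sym_diff B A)\<close>)
      qed
      finally show "cl_sign B (sym_diff B D) * x B * (\<Sum>A\<in>?P. cl_sign A (sym_diff A (sym_diff B D)) * y A * z (sym_diff A (sym_diff B D)))
         = (\<Sum>A\<in>?P. cl_sign A (sym_diff A D) * (cl_sign B (sym_diff B A) * x B * y (sym_diff B A)) * z (sym_diff A D))" .
    qed
    also have "\<dots> = (\<Sum>A\<in>?P. \<Sum>B\<in>?P. cl_sign A (sym_diff A D) * (cl_sign B (sym_diff B A) * x B * y (sym_diff B A)) * z (sym_diff A D))"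
      by (rule sum.swap)
    also have "\<dots> = cl_mult N (cl_mult N x y) z D"
      using True by (simp add: cl_mult_coeff sum_distrib_left sum_distrib_right)
    finally show ?thesis by simp
  qed
qed

section \<open>Bilinearity, monomials and the unit\<close>

lemma cl_mult_lin_left:
  "cl_mult N (\<lambda>C. a * x C + b * y C) z = (\<lambda>C. a * cl_mult N x z C + b * cl_mult N y z C)"
  by (rule ext) (simp add: cl_mult_coeff sum_distrib_left sum.distrib algebra_simps)

lemma cl_mult_lin_right:
  "cl_mult N z (\<lambda>C. a * x C + b * y C) = (\<lambda>C. a * cl_mult N z x C + b * cl_mult N z y C)"
  by (rule ext) (simp add: cl_mult_coeff sum_distrib_left sum.distrib algebra_simps)

lemma cl_mult_scale_left: "cl_mult N (\<lambda>C. a * x C) z = (\<lambda>C. a * cl_mult N x z C)"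
  using cl_mult_lin_left[of N a x 0 x] by simp

lemma cl_mult_scale_right: "cl_mult N z (\<lambda>C. a * x C) = (\<lambda>C. a * cl_mult N z x C)"
  using cl_mult_lin_right[of N z a x 0 x] by simp

lemma cl_mult_basis_left:
  assumes "A \<subseteq> {..<N}"
  shows "cl_mult N (cl_basis A) x C =
    (if C \<subseteq> {..<N} then cl_sign A (sym_diff A C) * x (sym_diff A C) else 0)"
proof -
  have "(\<Sum>B\<in>Pow {..<N}. cl_sign B (sym_diff B C) * cl_basis A B * x (sym_diff B C)) =
    (\<Sum>B\<in>Pow {..<N}. if B = A then cl_sign A (sym_diff A C) * x (sym_diff A C) else 0)"
    by (rule sum.cong) (auto simp: cl_basis_def)
  also have "\<dots> = cl_sign A (sym_diff A C) * x (sym_diff A C)"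
    using assms by (simp only: sum.delta finite_Pow_iff finite_lessThan) simp
  finally show ?thesis by (simp only: cl_mult_coeff)
qed

lemma cl_mult_basis_right:
  assumes "A \<subseteq> {..<N}"
  shows "cl_mult N x (cl_basis A) C =
    (if C \<subseteq> {..<N} then cl_sign (sym_diff A C) A * x (sym_diff A C) else 0)"
proof (cases "C \<subseteq> {..<N}")
  case True
  have e: "sym_diff B C = A \<longleftrightarrow> B = sym_diff A C" for B by blast
  have e2: "sym_diff (sym_diff A C) C = A" by blast
  have "(\<Sum>B\<in>Pow {..<N}. cl_sign B (sym_diff B C) * x B * cl_basis A (sym_diff B C)) =
    (\<Sum>B\<in>Pow {..<N}. if B = sym_diff A C then cl_sign (sym_diff A C) A * x (sym_diff A C) else 0)"
    unfolding cl_basis_def e by (rule sum.cong[OF refl]) (simp add: e2)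
  also have "\<dots> = cl_sign (sym_diff A C) A * x (sym_diff A C)"
  proof -
    have "sym_diff A C \<in> Pow {..<N}" using assms True by auto
    then show ?thesis by (simp only: sum.delta finite_Pow_iff finite_lessThan if_True)
  qed
  finally show ?thesis using True by (simp only: cl_mult_coeff if_True)
qed (simp add: cl_mult_coeff)

lemma cl_mult_basis:
  assumes "A \<subseteq> {..<N}" "B \<subseteq> {..<N}"
  shows "cl_mult N (cl_basis A) (cl_basis B) = (\<lambda>C. cl_sign A B * cl_basis (sym_diff A B) C)"
proof
  fix C
  have eq: "sym_diff A C = B \<longleftrightarrow> C = sym_diff A B" by blast
  have e2: "sym_diff A (sym_diff A B) = B" by blast
  have "sym_diff A B \<subseteq> {..<N}" using assms by auto
  then show "cl_mult N (cl_basis A) (cl_basis B) C = cl_sign A B * cl_basis (sym_diff A B) C"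
    unfolding cl_mult_basis_left[OF assms(1)] by (simp only: cl_basis_def eq) (simp add: e2)
qed

lemma cl_basis_commute:
  assumes "A \<subseteq> {..<N}" "B \<subseteq> {..<N}"
  shows "cl_mult N (cl_basis A) (cl_basis B) =
    (\<lambda>C. (- 1) ^ (card A * card B + card (A \<inter> B)) * cl_mult N (cl_basis B) (cl_basis A) C)"
proof -
  have "finite A" "finite B" using assms finite_subset by auto
  then show ?thesis using cl_sign_swap[of A B]
    by (simp only: cl_mult_basis[OF assms] cl_mult_basis[OF assms(2,1)] Un_commute mult.assoc)
qed

lemma cl_one_basis: "cl_one = cl_basis {}"
  by (simp add: cl_one_def cl_basis_def)

lemma cl_mult_one_left:
  assumes "cl_supp N x"
  shows "cl_mult N cl_one x = x"
proof
  fix C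
  show "cl_mult N cl_one x C = x C"
    using assms by (auto simp: cl_one_basis cl_mult_basis_left cl_supp_def cl_sign_def)
qed

lemma cl_mult_one_right:
  assumes "cl_supp N x"
  shows "cl_mult N x cl_one = x"
proof
  fix C
  show "cl_mult N x cl_one C = x C"
    using assms by (auto simp: cl_one_basis cl_mult_basis_right cl_supp_def cl_sign_def)
qed

lemma cl_supp_mult [simp]: "cl_supp N (cl_mult N x y)"
  by (simp add: cl_supp_def cl_mult_coeff)

lemma cl_supp_basis: "A \<subseteq> {..<N} \<Longrightarrow> cl_supp N (cl_basis A)"
  by (simp add: cl_supp_def cl_basis_def)

lemma cl_supp_one [simp]: "cl_supp N cl_one"
  by (simp add: cl_one_basis cl_supp_basis)

lemma cl_supp_lin: "cl_supp N x \<Longrightarrow> cl_supp N y \<Longrightarrow> cl_supp N (\<lambda>C. a * x C + b * y C)"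
  unfolding cl_supp_def by (metis add.right_neutral mult_zero_right)

lemma cl_supp_prod [simp]: "cl_supp N (cl_prod N xs)"
  by (cases xs) (simp_all add: cl_prod_def)

text \<open>Only equal monomials contribute to the scalar part, with the same sign
  \<open>cl_sign A A\<close> in either order. Hence the scalar part is a trace.\<close>

lemma cl_mult_scalar_part_commute: "cl_mult N x y {} = cl_mult N y x {}"
  by (simp add: cl_mult_coeff) (rule sum.cong, auto)

text \<open>Here h is the inverse of g, so y is the conjugate of x by g, and a trace does not change
  under conjugation.\<close>

lemma scalar_part_conj:
  assumes "cl_mult N g x = cl_mult N y g" "cl_mult N g h = cl_one" "cl_mult N h g = cl_one"
    and "cl_supp N x" "cl_supp N y"
  shows "x {} = y {}"
proof -
  have "x = cl_mult N h (cl_mult N y g)"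
    using assms by (metis cl_mult_assoc cl_mult_one_left)
  then have "x {} = cl_mult N (cl_mult N y g) h {}"
    using cl_mult_scalar_part_commute by metis
  also have "cl_mult N (cl_mult N y g) h = y"
    using assms by (simp add: cl_mult_assoc cl_mult_one_right)
  finally show ?thesis .
qed

subsection \<open>The maximal torus\<close>

text \<open>Otherwise the simplifier turns the dimension \<open>2 * n + 1\<close> into \<open>Suc (2 * n)\<close>.\<close>

declare One_nat_def [simp del]

abbreviation cl_plane :: "nat \<Rightarrow> cliff" where
  "cl_plane j \<equiv> cl_basis {2 * j, 2 * j + 1}"

text \<open>Since \<open>cl_plane j\<close> squares to -1, this is Euler's formula for the
  exponential of s / 2 times \<open>cl_plane j\<close>.\<close>

lemma torus_factor_eq:
  "torus_factor j s = (\<lambda>C. of_real (cos (s / 2)) * cl_one C + of_real (sin (s / 2)) * cl_plane j C)"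
  by (rule ext) (auto simp: torus_factor_def cl_one_def cl_basis_def)

lemma plane_subset: "j < n \<Longrightarrow> {2 * j, 2 * j + 1} \<subseteq> {..<2 * n + (1::nat)}"
  by auto

lemma cl_supp_plane [simp]: "j < n \<Longrightarrow> cl_supp (2 * n + 1) (cl_plane j)"
  by (rule cl_supp_basis[OF plane_subset])

lemma cl_supp_torus_factor [simp]: "j < n \<Longrightarrow> cl_supp (2 * n + 1) (torus_factor j s)"
  unfolding torus_factor_eq by (intro cl_supp_lin cl_supp_one cl_supp_plane)

lemma cl_sign_plane_self: "cl_sign {2 * j, 2 * j + 1} {2 * j, 2 * j + 1} = - 1"
  by (simp add: cl_sign_prod)

lemma cl_plane_sq:
  assumes "j < n"
  shows "cl_mult (2 * n + 1) (cl_plane j) (cl_plane j) = (\<lambda>C. - cl_one C)"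
  using cl_mult_basis[OF plane_subset[OF assms] plane_subset[OF assms]] cl_sign_plane_self[of j]
  by (simp add: cl_one_basis)

lemma cl_plane_commute:
  assumes "j < n" "k < n"
  shows "cl_mult (2 * n + 1) (cl_plane j) (cl_plane k) = cl_mult (2 * n + 1) (cl_plane k) (cl_plane j)"
proof (cases "j = k")
  case False
  then have "{2 * j, 2 * j + 1} \<inter> {2 * k, 2 * k + 1} = {}" by (auto; presburger)
  then show ?thesis
    by (subst cl_basis_commute[OF plane_subset[OF assms(1)] plane_subset[OF assms(2)]]) simp
qed simp

lemma torus_factor_commute:
  assumes "j < n" "k < n"
  shows "cl_mult (2 * n + 1) (torus_factor j s) (torus_factor k t) =
    cl_mult (2 * n + 1) (torus_factor k t) (torus_factor j s)"
  unfolding torus_factor_eq cl_mult_lin_left cl_mult_lin_right cl_mult_one_left[OF cl_supp_one]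
    cl_mult_one_left[OF cl_supp_plane[OF assms(1)]] cl_mult_one_right[OF cl_supp_plane[OF assms(1)]]
    cl_mult_one_left[OF cl_supp_plane[OF assms(2)]] cl_mult_one_right[OF cl_supp_plane[OF assms(2)]]
    cl_plane_commute[OF assms]
  by (simp add: algebra_simps)

lemma torus_factor_add:
  assumes "j < n"
  shows "cl_mult (2 * n + 1) (torus_factor j s) (torus_factor j t) = torus_factor j (s + t)"
  unfolding torus_factor_eq cl_mult_lin_left cl_mult_lin_right cl_mult_one_left[OF cl_supp_one]
    cl_mult_one_left[OF cl_supp_plane[OF assms]] cl_mult_one_right[OF cl_supp_plane[OF assms]]
    cl_plane_sq[OF assms]
  by (simp add: add_divide_distrib cos_add sin_add algebra_simps)

lemma torus_factor_0 [simp]: "torus_factor j 0 = cl_one"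
  by (simp add: torus_factor_eq)

text \<open>Dropping the first k factors of \<open>torus_exp\<close> allows downward induction on k,
  one factor being prepended in each step.\<close>

definition torus_tail :: "nat \<Rightarrow> nat \<Rightarrow> (nat \<Rightarrow> real) \<Rightarrow> cliff" where
  "torus_tail n k t = cl_prod (2 * n + 1) (map (\<lambda>j. torus_factor j (t j)) [k..<n])"

lemma torus_exp_tail: "torus_exp n t = torus_tail n 0 t"
  by (simp add: torus_exp_def torus_tail_def)

lemma torus_tail_step:
  "k < n \<Longrightarrow> torus_tail n k t = cl_mult (2 * n + 1) (torus_factor k (t k)) (torus_tail n (Suc k) t)"
  by (simp add: torus_tail_def cl_prod_def upt_conv_Cons)

lemma torus_tail_end [simp]: "n \<le> k \<Longrightarrow> torus_tail n k t = cl_one"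
  by (simp add: torus_tail_def cl_prod_def)

lemma cl_supp_torus_tail [simp]: "cl_supp (2 * n + 1) (torus_tail n k t)"
  using cl_supp_prod by (simp add: torus_tail_def)

lemma cl_supp_torus_exp [simp]: "cl_supp (2 * n + 1) (torus_exp n t)"
  using cl_supp_torus_tail by (simp add: torus_exp_tail)

lemma torus_tail_induct [consumes 1, case_names last step]:
  assumes "k \<le> n" "P (n::nat)" "\<And>k. k < n \<Longrightarrow> P (Suc k) \<Longrightarrow> P k"
  shows "P k"
  using assms(1) by (induction rule: inc_induct) (use assms in auto)

lemma torus_factor_tail_commute:
  assumes "j < n" "k \<le> n"
  shows "cl_mult (2 * n + 1) (torus_factor j s) (torus_tail n k t) =
    cl_mult (2 * n + 1) (torus_tail n k t) (torus_factor j s)"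
  using assms(2)
proof (induction rule: torus_tail_induct)
  case last
  then show ?case using assms(1) by (simp add: cl_mult_one_left cl_mult_one_right)
next
  case (step k)
  show ?case
    unfolding torus_tail_step[OF step(1)]
    by (metis cl_mult_assoc step(2) torus_factor_commute[OF assms(1) step(1)])
qed

lemma torus_tail_add:
  assumes "k \<le> n"
  shows "cl_mult (2 * n + 1) (torus_tail n k s) (torus_tail n k t) = torus_tail n k (\<lambda>j. s j + t j)"
  using assms
proof (induction rule: torus_tail_induct)
  case last
  then show ?case by (simp add: cl_mult_one_left)
next
  case (step k)
  show ?case
    unfolding torus_tail_step[OF step(1)] torus_factor_add[OF step(1), symmetric] step(2)[symmetric]
    using torus_factor_tail_commute[OF step(1) Suc_leI[OF step(1)]]
    by (metis cl_mult_assoc)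
qed

lemma torus_exp_add:
  "cl_mult (2 * n + 1) (torus_exp n s) (torus_exp n t) = torus_exp n (\<lambda>j. s j + t j)"
  by (simp add: torus_exp_tail torus_tail_add)

definition axis :: "nat \<Rightarrow> real \<Rightarrow> nat \<Rightarrow> real" where
  "axis k s = (\<lambda>j. if j = k then s else 0)"

lemma torus_tail_0: "k \<le> n \<Longrightarrow> torus_tail n k (\<lambda>_. 0) = cl_one"
  by (induction rule: torus_tail_induct) (simp_all add: torus_tail_step cl_mult_one_left)

lemma torus_tail_axis:
  assumes "k \<le> n" "l < n"
  shows "torus_tail n k (axis l s) = (if k \<le> l then torus_factor l s else cl_one)"
  using assms(1)
proof (induction rule: torus_tail_induct)
  case last
  then show ?case using assms by simp
next
  case (step k)
  then show ?case using assms
    by (cases "k = l") (auto simp: torus_tail_step axis_def cl_mult_one_left cl_mult_one_right)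
qed

lemma torus_exp_axis: "l < n \<Longrightarrow> torus_exp n (axis l s) = torus_factor l s"
  by (simp add: torus_exp_tail torus_tail_axis)

lemma torus_exp_0: "torus_exp n (\<lambda>_. 0) = cl_one"
  by (simp add: torus_exp_tail torus_tail_0)

text \<open>A vector arises from 0 by adding one coordinate at a time. Together with
  \<open>torus_exp_add\<close> and \<open>torus_exp_axis\<close> this reduces claims about the torus
  to single factors.\<close>

lemma torus_exp_induct [consumes 1, case_names zero step]:
  assumes t: "t \<in> topspace (Euclidean_space n)"
    and zero: "P (\<lambda>_. 0)"
    and step: "\<And>x j s. P x \<Longrightarrow> j < n \<Longrightarrow> P (\<lambda>i. x i + axis j s i)"
  shows "P t"
proof -
  have "P (\<lambda>i. if i < k then t i else 0)" if "k \<le> n" for k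
    using that
  proof (induction k)
    case 0
    then show ?case using zero by simp
  next
    case (Suc k)
    have "(\<lambda>i. if i < Suc k then t i else 0) = (\<lambda>i. (if i < k then t i else 0) + axis k (t k) i)"
      by (auto simp: axis_def less_Suc_eq)
    then show ?case using Suc step by simp
  qed
  moreover have "(\<lambda>i. if i < n then t i else 0) = t"
    using t by (auto simp: topspace_Euclidean_space)
  ultimately show ?thesis by (metis le_refl)
qed

section \<open>Coefficients of torus elements\<close>

definition planes :: "nat set \<Rightarrow> nat set" where
  "planes S = {m. m div 2 \<in> S}"

lemma torus_factor_mult_coeff:
  assumes "k < n" "C \<subseteq> {..<2 * n + 1}" "cl_supp (2 * n + 1) x"
  shows "cl_mult (2 * n + 1) (torus_factor k s) x C = of_real (cos (s / 2)) * x C +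
    of_real (sin (s / 2)) * (cl_sign {2 * k, 2 * k + 1} (sym_diff {2 * k, 2 * k + 1} C) *
       x (sym_diff {2 * k, 2 * k + 1} C))"
  unfolding torus_factor_eq cl_mult_lin_left cl_mult_one_left[OF assms(3)]
    cl_mult_basis_left[OF plane_subset[OF assms(1)]] using assms(2) by simp

lemma mult_torus_factor_coeff:
  assumes "k < n" "C \<subseteq> {..<2 * n + 1}" "cl_supp (2 * n + 1) x"
  shows "cl_mult (2 * n + 1) x (torus_factor k s) C = of_real (cos (s / 2)) * x C +
    of_real (sin (s / 2)) * (cl_sign (sym_diff {2 * k, 2 * k + 1} C) {2 * k, 2 * k + 1} *
       x (sym_diff {2 * k, 2 * k + 1} C))"
  unfolding torus_factor_eq cl_mult_lin_right cl_mult_one_right[OF assms(3)]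
    cl_mult_basis_right[OF plane_subset[OF assms(1)]] using assms(2) by simp

lemma planes_subset: "S \<subseteq> {..<n} \<Longrightarrow> planes S \<subseteq> {..<2 * n + 1}"
  by (fastforce simp: planes_def)

text \<open>The tail is a product of elements in the generators from 2 * k on, so no smaller index
  can occur in its monomials.\<close>

lemma torus_tail_low:
  assumes "k \<le> n" "c \<in> C" "c < 2 * k"
  shows "torus_tail n k t C = 0"
  using assms
proof (induction arbitrary: c C rule: torus_tail_induct)
  case last
  then show ?case by (auto simp: cl_one_def)
next
  case (step k)
  show ?case
  proof (cases "C \<subseteq> {..<2 * n + 1}")
    case True
    have "c \<in> sym_diff {2 * k, 2 * k + 1} C" using step by auto
    then have "torus_tail n (Suc k) t (sym_diff {2 * k, 2 * k + 1} C) = 0"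
      by (rule step(2)) (use step in simp)
    moreover have "torus_tail n (Suc k) t C = 0" using step by simp
    ultimately show ?thesis using step(1)
      by (simp add: torus_tail_step torus_factor_mult_coeff[OF step(1) True])
  next
    case False
    then show ?thesis using cl_supp_torus_tail[of n k t] by (auto simp: cl_supp_def)
  qed
qed

lemma torus_tail_coeff:
  assumes "k \<le> n" "S \<subseteq> {k..<n}"
  shows "torus_tail n k t (planes S) =
    (\<Prod>j\<in>S. of_real (sin (t j / 2))) * (\<Prod>j\<in>{k..<n} - S. of_real (cos (t j / 2)))"
  using assms
proof (induction arbitrary: S rule: torus_tail_induct)
  case last
  then show ?case by (simp add: cl_one_def planes_def)
next
  case (step k)
  let ?J = "{2 * k, 2 * k + 1}"
  have sub: "planes S \<subseteq> {..<2 * n + 1}" by (rule planes_subset) (use step in auto)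
  have fin: "finite S" using step(3) finite_subset by auto
  note eq = torus_tail_step[OF step(1)] torus_factor_mult_coeff[OF step(1) sub cl_supp_torus_tail]
  have kin: "{k..<n} = insert k {Suc k..<n}" using step(1) by auto
  show ?case
  proof (cases "k \<in> S")
    case False
    then have S: "S \<subseteq> {Suc k..<n}" using step(3) by (auto simp: Suc_le_eq le_less)
    \<comment> \<open>The sine term of factor k would need a monomial of the tail that contains 2 *
      k, and there is none; only the cosine term remains.\<close>
    have "2 * k \<in> sym_diff ?J (planes S)" using False by (auto simp: planes_def)
    then have "torus_tail n (Suc k) t (sym_diff ?J (planes S)) = 0"
      by (intro torus_tail_low) (use step(1) in auto)
    moreover have "{k..<n} - S = insert k ({Suc k..<n} - S)" using kin False by auto
    ultimately show ?thesis unfolding eq step(2)[OF S] by simp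
  next
    case True
    define R where "R = S - {k}"
    have R: "R \<subseteq> {Suc k..<n}" using step(3) by (auto simp: R_def Suc_le_eq le_less)
    have sd: "sym_diff ?J (planes S) = planes R"
    proof -
      have "m div 2 = k \<longleftrightarrow> m = 2 * k \<or> m = 2 * k + 1" for m :: nat by auto
      then show ?thesis using True by (auto simp: planes_def R_def)
    qed
    \<comment> \<open>Now it is the cosine term that vanishes, as the tail cannot supply the plane
      k.\<close>
    have "torus_tail n (Suc k) t (planes S) = 0"
      by (rule torus_tail_low[of _ _ "2 * k"]) (use step(1) True in \<open>auto simp: planes_def\<close>)
    moreover have "cl_sign ?J (planes R) = 1"
    proof -
      have "2 * k + 1 < m" if "m \<in> planes R" for m
      proof -
        have "Suc k \<le> m div 2" using that R by (auto simp: planes_def)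
        then show ?thesis by linarith
      qed
      then have empty: "{(a, b). a \<in> ?J \<and> b \<in> planes R \<and> b \<le> a} = {}" by fastforce
      show ?thesis unfolding cl_sign_def empty by simp
    qed
    moreover have "(\<Prod>j\<in>S. complex_of_real (sin (t j / 2))) = of_real (sin (t k / 2)) * (\<Prod>j\<in>R. of_real (sin (t j / 2)))"
      unfolding R_def using True fin by (simp add: prod.remove)
    moreover have "{k..<n} - S = {Suc k..<n} - R" using kin True by (auto simp: R_def)
    ultimately show ?thesis unfolding eq sd step(2)[OF R] by simp
  qed
qed

lemma torus_exp_coeff:
  "S \<subseteq> {..<n} \<Longrightarrow> torus_exp n t (planes S) =
    (\<Prod>j\<in>S. of_real (sin (t j / 2))) * (\<Prod>j\<in>{..<n} - S. of_real (cos (t j / 2)))"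
  using torus_tail_coeff[of 0 n S t] by (simp add: torus_exp_tail lessThan_atLeast0)

lemma torus_exp_scalar_part: "torus_exp n t {} = of_real (\<Prod>j<n. cos (t j / 2))"
  using torus_exp_coeff[of "{}" n t] by (simp add: planes_def)

subsection \<open>The weight lattice\<close>

text \<open>The weights of the spin representation, extended to the Clifford algebra as linear forms: the
  set \<open>T\<close> selects the coordinates whose half angle enters with a negative sign.\<close>

definition spin_char :: "nat \<Rightarrow> nat set \<Rightarrow> cliff \<Rightarrow> complex" where
  "spin_char n T x = (\<Sum>S\<in>Pow {..<n}. (\<Prod>j\<in>S. if j \<in> T then - \<i> else \<i>) * x (planes S))"

text \<open>The weights \<plusminus>i turn the sum over all choices of sine and cosine into the
  expansion of a product of factors cos \<plusminus> i sin.\<close>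

lemma spin_char_torus_exp:
  "spin_char n T (torus_exp n t) = cis (\<Sum>j<n. (if j \<in> T then - 1 else 1) * t j / 2)"
proof -
  have "spin_char n T (torus_exp n t) =
    (\<Sum>S\<in>Pow {..<n}. (\<Prod>j\<in>S. (if j \<in> T then - \<i> else \<i>) * of_real (sin (t j / 2))) *
       (\<Prod>j\<in>{..<n} - S. of_real (cos (t j / 2))))"
    unfolding spin_char_def by (rule sum.cong) (auto simp: torus_exp_coeff prod.distrib)
  also have "\<dots> = (\<Prod>j<n. (if j \<in> T then - \<i> else \<i>) * of_real (sin (t j / 2)) + of_real (cos (t j / 2)))"
    by (rule prod_add[symmetric]) simp
  also have "\<dots> = (\<Prod>j<n. cis ((if j \<in> T then - 1 else 1) * t j / 2))"
    by (rule prod.cong) (auto simp: complex_eq_iff)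
  also have "\<dots> = cis (\<Sum>j<n. (if j \<in> T then - 1 else 1) * t j / 2)"
    by (induction n) (simp_all add: cis_mult)
  finally show ?thesis .
qed

lemma continuous_on_spin_char: "continuous_on X (spin_char n T)"
proof -
  have "continuous_on X (\<lambda>x :: cliff. x A)" for A
    by (rule continuous_on_subset[OF continuous_on_product_coordinates]) simp
  then show ?thesis unfolding spin_char_def by (intro continuous_intros)
qed

lemma cis_sum: "(\<Prod>j<(n::nat). cis (f j)) = cis (\<Sum>j<n. f j)"
  by (induction n) (simp_all add: cis_mult)

lemma pairing_axis: "j < n \<Longrightarrow> pairing n l (axis j s) = l j * s"
  by (simp add: pairing_def axis_def if_distrib cong: if_cong)

lemma pairing_add: "pairing n l (\<lambda>j. s j + t j) = pairing n l s + pairing n l t"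
  by (simp add: pairing_def algebra_simps sum.distrib)

text \<open>The quotient of \<open>spin_char n {}\<close> by \<open>spin_char n {j}\<close> is the
  coordinate character \<open>cis (t j)\<close>, and \<open>spin_char n {}\<close> itself shifts all
  coordinates by 1 / 2. None of these vanishes on the torus, so quotients and integral powers stay
  continuous there.\<close>

lemma int_half_int_in_weight_lattice:
  assumes l: "l \<in> topspace (Euclidean_space n)"
    and *: "\<And>j. j < n \<Longrightarrow> l j = of_int (c j) + (if h then 1 / 2 else 0)"
  shows "l \<in> weight_lattice n"
proof -
  define f where "f x = (if h then spin_char n {} x else 1) *
      (\<Prod>j<n. (spin_char n {} x / spin_char n {j} x) powi c j)" for x
  have f: "f (torus_exp n t) = cis (pairing n l t)" for t
  proof -
    have "spin_char n {} (torus_exp n t) / spin_char n {j} (torus_exp n t) = cis (t j)" if "j < n" for j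
    proof -
      have "(\<Sum>i<n. t i / 2) - (\<Sum>i<n. (if i \<in> {j} then - 1 else 1) * t i / 2) = (\<Sum>i<n. if i = j then t i else 0)"
        unfolding sum_subtractf[symmetric] by (rule sum.cong) auto
      also have "\<dots> = t j" using that by simp
      finally show ?thesis unfolding spin_char_torus_exp by (simp add: cis_divide)
    qed
    then have "f (torus_exp n t) = (if h then cis (\<Sum>j<n. t j / 2) else 1) * cis (\<Sum>j<n. of_int (c j) * t j)"
      unfolding f_def spin_char_torus_exp[of n "{}"] by (simp add: cis_power_int cis_sum)
    also have "\<dots> = cis (\<Sum>j<n. (if h then t j / 2 else 0) + of_int (c j) * t j)"
      by (simp add: cis_mult sum.distrib)
    also have "(\<Sum>j<n. (if h then t j / 2 else 0) + of_int (c j) * t j) = pairing n l t"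
      unfolding pairing_def by (rule sum.cong) (auto simp: * algebra_simps)
    finally show ?thesis .
  qed
  have "spin_char n T x \<noteq> 0" if "x \<in> max_torus n" for T x
    using that by (auto simp: max_torus_def spin_char_torus_exp)
  then have "continuous_on (max_torus n) f"
    unfolding f_def by (cases h) (auto intro!: continuous_intros continuous_on_spin_char)
  moreover have "f (cl_mult (2 * n + 1) x y) = f x * f y" if "x \<in> max_torus n" "y \<in> max_torus n" for x y
    using that by (auto simp: max_torus_def torus_exp_add f cis_mult pairing_add)
  moreover have "norm (f x) = 1" if "x \<in> max_torus n" for x
    using that by (auto simp: max_torus_def f)
  ultimately have "f \<in> torus_characters n" by (simp add: torus_characters_def)
  then show ?thesis using l f by (auto simp: weight_lattice_def)
qed

text \<open>A full turn lifts to -1, as \<open>Spin\<close> covers the rotations twice. Two full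
  turns, or one in each of two planes, lift to 1.\<close>

lemma torus_factor_2pi: "torus_factor j (2 * pi) = (\<lambda>C. - cl_one C)"
  "torus_factor j (- 2 * pi) = (\<lambda>C. - cl_one C)"
  by (simp_all add: torus_factor_eq)

lemma torus_factor_4pi: "torus_factor j (4 * pi) = cl_one"
  using sin_npi[of 2] cos_npi[of 2] by (simp add: torus_factor_eq)

lemma cis_eq_1_imp: "cis (2 * pi * x) = 1 \<Longrightarrow> x \<in> \<int>"
  using cos_one_2pi_int[of "2 * pi * x"] by (auto simp: complex_eq_iff)

lemma axis_topspace: "j < n \<Longrightarrow> axis j s \<in> topspace (Euclidean_space n)"
  by (auto simp: axis_def topspace_Euclidean_space)

text \<open>The differential of a character takes values in the multiples of 2 * pi on the kernel of
  \<open>torus_exp\<close>. Two full turns in plane 0 and opposite full turns in the planes j and 0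
  give the two claims.\<close>

lemma weight_lattice_imp:
  assumes "l \<in> weight_lattice n" "n > 0"
  shows "2 * l 0 \<in> \<int>" "j < n \<Longrightarrow> l j - l 0 \<in> \<int>"
proof -
  have triv: "cis (pairing n l t) = 1" if "t \<in> topspace (Euclidean_space n)" "torus_exp n t = cl_one" for t
  proof -
    obtain f where f: "\<And>t. t \<in> topspace (Euclidean_space n) \<Longrightarrow> f (torus_exp n t) = cis (pairing n l t)"
      using assms by (auto simp: weight_lattice_def)
    have "cis (pairing n l t) = f (torus_exp n (\<lambda>_. 0))" using f[OF that(1)] that(2) by (simp add: torus_exp_0)
    also have "\<dots> = 1" by (subst f) (simp_all add: topspace_Euclidean_space pairing_def)
    finally show ?thesis .
  qed
  have "cis (pairing n l (axis 0 (4 * pi))) = 1"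
    by (rule triv) (simp_all add: axis_topspace torus_exp_axis torus_factor_4pi assms)
  then show "2 * l 0 \<in> \<int>"
    using assms by (intro cis_eq_1_imp) (simp add: pairing_axis algebra_simps)
  show "l j - l 0 \<in> \<int>" if j: "j < n"
  proof -
    let ?t = "\<lambda>i. axis j (2 * pi) i + axis 0 (- 2 * pi) i"
    have "cis (pairing n l ?t) = 1"
    proof (rule triv)
      show "?t \<in> topspace (Euclidean_space n)" using j by (auto simp: axis_def topspace_Euclidean_space)
      show "torus_exp n ?t = cl_one"
        unfolding torus_exp_add[symmetric] torus_exp_axis[OF j] torus_exp_axis[OF assms(2)] torus_factor_2pi
        using cl_mult_scale_left[of _ "-1"] cl_mult_scale_right[of _ _ "-1"] by (simp add: cl_mult_one_left)
    qed
    then show ?thesis using j assms unfolding pairing_add pairing_axis[OF j] pairing_axis[OF assms(2)]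
      by (intro cis_eq_1_imp) (simp add: algebra_simps)
  qed
qed

theorem weight_lattice_eq:
  assumes "n > 0"
  shows "weight_lattice n = {l. (\<forall>j\<ge>n. l j = 0) \<and> ((\<forall>j<n. l j \<in> \<int>) \<or> (\<forall>j<n. l j - 1 / 2 \<in> \<int>))}"
proof (intro equalityI subsetI)
  fix l :: "nat \<Rightarrow> real" assume l: "l \<in> weight_lattice n"
  then have top: "\<forall>j\<ge>n. l j = 0" by (simp add: weight_lattice_def topspace_Euclidean_space)
  note w = weight_lattice_imp[OF l assms]
  obtain z where z: "2 * l 0 = of_int z" using w(1) by (auto elim: Ints_cases)
  have "(\<forall>j<n. l j \<in> \<int>) \<or> (\<forall>j<n. l j - 1 / 2 \<in> \<int>)"
  proof (cases "even z")
    case True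
    then have "l 0 \<in> \<int>" using z by (auto elim!: evenE)
    then have "l j \<in> \<int>" if "j < n" for j using Ints_add[OF w(2)[OF that]] by simp
    then show ?thesis by blast
  next
    case False
    then have "l 0 - 1 / 2 \<in> \<int>" using z by (auto elim!: oddE simp: field_simps)
    then have "l j - 1 / 2 \<in> \<int>" if "j < n" for j using Ints_add[OF w(2)[OF that]] by fastforce
    then show ?thesis by blast
  qed
  then show "l \<in> {l. (\<forall>j\<ge>n. l j = 0) \<and> ((\<forall>j<n. l j \<in> \<int>) \<or> (\<forall>j<n. l j - 1 / 2 \<in> \<int>))}"
    using top by simp
next
  fix l :: "nat \<Rightarrow> real" assume "l \<in> {l. (\<forall>j\<ge>n. l j = 0) \<and> ((\<forall>j<n. l j \<in> \<int>) \<or> (\<forall>j<n. l j - 1 / 2 \<in> \<int>))}"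
  then have top: "l \<in> topspace (Euclidean_space n)"
    and or: "(\<forall>j<n. l j \<in> \<int>) \<or> (\<forall>j<n. l j - 1 / 2 \<in> \<int>)" by (simp_all add: topspace_Euclidean_space)
  from or show "l \<in> weight_lattice n"
  proof
    assume "\<forall>j<n. l j \<in> \<int>"
    then show ?thesis
      by (intro int_half_int_in_weight_lattice[OF top, of "\<lambda>j. \<lfloor>l j\<rfloor>" False]) simp
  next
    assume "\<forall>j<n. l j - 1 / 2 \<in> \<int>"
    then have "l j = of_int \<lfloor>l j - 1 / 2\<rfloor> + 1 / 2" if "j < n" for j
      using that by (simp add: of_int_floor_cancel[THEN iffD2])
    then show ?thesis
      by (intro int_half_int_in_weight_lattice[OF top, of "\<lambda>j. \<lfloor>l j - 1 / 2\<rfloor>" True]) simp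
  qed
qed

subsection \<open>The roots\<close>

text \<open>Compare the derivatives at s = 0: the left side gives p / 2, the right side q / 2 + i *
  u * a. Real and imaginary parts are differentiated separately as functions of a real
  variable.\<close>

lemma eigen_equation_deriv:
  fixes a p q :: complex
  assumes eq: "\<And>s. of_real (cos (s / 2)) * a + of_real (sin (s / 2)) * p =
    cis (u * s) * (of_real (cos (s / 2)) * a + of_real (sin (s / 2)) * q)"
  shows "p - q = 2 * \<i> * of_real u * a"
proof -
  have "DERIV (\<lambda>s. cos (s / 2) * Re a + sin (s / 2) * Re p) 0 :> Re p / 2"
    by (auto intro!: derivative_eq_intros)
  moreover have "DERIV (\<lambda>s. cos (u * s) * (cos (s / 2) * Re a + sin (s / 2) * Re q) -
      sin (u * s) * (cos (s / 2) * Im a + sin (s / 2) * Im q)) 0 :> Re q / 2 - u * Im a"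
    by (auto intro!: derivative_eq_intros)
  moreover have "cos (s / 2) * Re a + sin (s / 2) * Re p = cos (u * s) * (cos (s / 2) * Re a + sin (s / 2) * Re q) -
      sin (u * s) * (cos (s / 2) * Im a + sin (s / 2) * Im q)" for s
    using arg_cong[OF eq[of s], of Re] by simp
  ultimately have re: "Re p / 2 = Re q / 2 - u * Im a" using DERIV_unique by fastforce
  have "DERIV (\<lambda>s. cos (s / 2) * Im a + sin (s / 2) * Im p) 0 :> Im p / 2"
    by (auto intro!: derivative_eq_intros)
  moreover have "DERIV (\<lambda>s. cos (u * s) * (cos (s / 2) * Im a + sin (s / 2) * Im q) +
      sin (u * s) * (cos (s / 2) * Re a + sin (s / 2) * Re q)) 0 :> Im q / 2 + u * Re a"
    by (auto intro!: derivative_eq_intros)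
  moreover have "cos (s / 2) * Im a + sin (s / 2) * Im p = cos (u * s) * (cos (s / 2) * Im a + sin (s / 2) * Im q) +
      sin (u * s) * (cos (s / 2) * Re a + sin (s / 2) * Re q)" for s
    using arg_cong[OF eq[of s], of Im] by simp
  ultimately have im: "Im p / 2 = Im q / 2 + u * Re a" using DERIV_unique by fastforce
  show ?thesis using re im by (simp add: complex_eq_iff)
qed

text \<open>These are the vectors \<open>\<plusminus> e i\<close> and
  \<open>\<plusminus> e i \<plusminus> e j\<close>; counting nonzero entries treats short and long
  roots together.\<close>

definition B_roots :: "nat \<Rightarrow> (nat \<Rightarrow> real) set" where
  "B_roots n = {u \<in> topspace (Euclidean_space n). u \<noteq> (\<lambda>_. 0) \<and> (\<forall>j. u j \<in> {- 1, 0, 1}) \<and>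
     card {j. u j \<noteq> 0} \<le> 2}"

text \<open>Write \<open>J\<close> for the plane \<open>{2 * j, 2 * j + 1}\<close>. Differentiating the eigenvector equation along the
  \<open>j\<close>-th coordinate at \<open>0\<close> gives \<open>e J * X - X * e J = 2 * \<i> * u j * X\<close>. At a set \<open>C\<close> with
  \<open>X C \<noteq> 0\<close> this forces \<open>u j = 0\<close> if \<open>C\<close> meets \<open>J\<close> evenly; otherwise it relates \<open>X C\<close> to
  \<open>X (sym_diff J C)\<close>, and going back from there gives \<open>(u j)\<^sup>2 = 1\<close>.\<close>

lemma roots_subset: "roots n \<subseteq> B_roots n"
proof
  fix u assume "u \<in> roots n"
  then obtain X where u: "u \<in> topspace (Euclidean_space n)" "u \<noteq> (\<lambda>_. 0)"
    and X: "X \<in> spin_Lie (2 * n + 1)" "X \<noteq> (\<lambda>_. 0)"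
    and eq: "\<And>t. t \<in> topspace (Euclidean_space n) \<Longrightarrow> cl_mult (2 * n + 1) (torus_exp n t) X =
          (\<lambda>A. cis (pairing n u t) * cl_mult (2 * n + 1) X (torus_exp n t) A)"
    by (auto simp: roots_def)
  let ?J = "\<lambda>j. {2 * j, 2 * j + 1} :: nat set"
  have supp: "cl_supp (2 * n + 1) X" using X by (auto simp: spin_Lie_def cl_supp_def)
  have inf: "(cl_sign (?J j) (sym_diff (?J j) C) - cl_sign (sym_diff (?J j) C) (?J j)) * X (sym_diff (?J j) C) =
      2 * \<i> * of_real (u j) * X C" if j: "j < n" and C: "C \<subseteq> {..<2 * n + 1}" for j C
  proof -
    have "cl_sign (?J j) (sym_diff (?J j) C) * X (sym_diff (?J j) C) -
      cl_sign (sym_diff (?J j) C) (?J j) * X (sym_diff (?J j) C) = 2 * \<i> * of_real (u j) * X C"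
    proof (rule eigen_equation_deriv)
      fix s
      have "cl_mult (2 * n + 1) (torus_factor j s) X C = cis (u j * s) * cl_mult (2 * n + 1) X (torus_factor j s) C"
        using fun_cong[OF eq[OF axis_topspace[OF j, of s]], of C] j
        by (simp add: torus_exp_axis pairing_axis)
      then show "of_real (cos (s / 2)) * X C + of_real (sin (s / 2)) * (cl_sign (?J j) (sym_diff (?J j) C) * X (sym_diff (?J j) C)) =
        cis (u j * s) * (of_real (cos (s / 2)) * X C + of_real (sin (s / 2)) * (cl_sign (sym_diff (?J j) C) (?J j) * X (sym_diff (?J j) C)))"
        unfolding torus_factor_mult_coeff[OF j C supp] mult_torus_factor_coeff[OF j C supp] .
    qed
    then show ?thesis by (simp add: algebra_simps)
  qed
  obtain C where C: "X C \<noteq> 0" using X by auto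
  then have Csub: "C \<subseteq> {..<2 * n + 1}" and C2: "card C = 2" using X by (auto simp: spin_Lie_def)
  have finC: "finite C" using Csub finite_subset by auto
  have main: "(even (card (?J j \<inter> C)) \<longrightarrow> u j = 0) \<and> (odd (card (?J j \<inter> C)) \<longrightarrow> (u j)\<^sup>2 = 1)" if j: "j < n" for j
  proof -
    define B where "B = sym_diff (?J j) C"
    have B: "B \<subseteq> {..<2 * n + 1}" using Csub plane_subset[OF j] by (auto simp: B_def)
    have finB: "finite B" using B finite_subset by auto
    have JB: "sym_diff (?J j) B = C" by (auto simp: B_def)
    \<comment> \<open>Passing from C to B replaces the part inside the plane by its complement in
      the plane, which preserves the parity of its size.\<close>
    have "card (?J j \<inter> B) + card (?J j \<inter> C) = 2"
    proof -
      have "?J j = (?J j \<inter> B) \<union> (?J j \<inter> C)" "(?J j \<inter> B) \<inter> (?J j \<inter> C) = {}" by (auto simp: B_def)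
      then have "card (?J j) = card (?J j \<inter> B) + card (?J j \<inter> C)"
        by (metis card_Un_disjoint finite_Int finite.emptyI finite.insertI)
      then show ?thesis by simp
    qed
    then have par: "even (card (?J j \<inter> B)) \<longleftrightarrow> even (card (?J j \<inter> C))" by presburger
    have sw: "cl_sign (?J j) D = (- 1) ^ card (?J j \<inter> D) * cl_sign D (?J j)" if "finite D" for D
      using cl_sign_swap[of "?J j" D] that by (simp add: power_add power_mult)
    note eqC = inf[OF j Csub, folded B_def] and eqB = inf[OF j B, unfolded JB]
    show ?thesis
    proof (cases "even (card (?J j \<inter> C))")
      case True
      then have "cl_sign (?J j) B = cl_sign B (?J j)" using sw[OF finB] par by simp
      then show ?thesis using eqC C True by simp
    next
      case False
      then have "cl_sign B (?J j) = - cl_sign (?J j) B" "cl_sign C (?J j) = - cl_sign (?J j) C"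
        using sw[OF finB] sw[OF finC] par by simp_all
      then have 1: "cl_sign (?J j) B * X B = \<i> * of_real (u j) * X C"
        and 2: "cl_sign (?J j) C * X C = \<i> * of_real (u j) * X B"
        using eqC eqB by simp_all
      \<comment> \<open>By the bicharacter property the two signs multiply to the sign of the plane
        with itself; this -1 cancels the square of the imaginary unit.\<close>
      have "sym_diff B C = ?J j" by (auto simp: B_def)
      then have "cl_sign (?J j) B * cl_sign (?J j) C = - 1"
        using cl_sign_sym_diff_right[of "?J j" B C] finB finC cl_sign_plane_self[of j] by simp
      then have "- X C = cl_sign (?J j) B * (cl_sign (?J j) C * X C)" by (simp flip: mult.assoc)
      also have "\<dots> = \<i> * of_real (u j) * (\<i> * of_real (u j) * X C)" unfolding 2 by (simp flip: 1)
      also have "\<dots> = - (of_real ((u j)\<^sup>2) * X C)" by (simp add: power2_eq_square algebra_simps)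
      finally have "of_real ((u j)\<^sup>2) = (1 :: complex)" using C by simp
      then show ?thesis using False by (simp only: of_real_eq_1_iff) simp
    qed
  qed
  have zero: "u j = 0" if "j \<ge> n" for j using u that by (auto simp: topspace_Euclidean_space)
  \<comment> \<open>Each nonzero coordinate needs a plane that meets C, and the two elements of C
    lie in at most two planes.\<close>
  have "{j. u j \<noteq> 0} \<subseteq> (\<lambda>m. m div 2) ` C"
  proof
    fix j assume "j \<in> {j. u j \<noteq> 0}"
    then have "j < n" "u j \<noteq> 0" using zero not_le by auto
    then have "odd (card (?J j \<inter> C))" using main by blast
    then have "?J j \<inter> C \<noteq> {}" by fastforce
    then obtain m where "m \<in> C" "m = 2 * j \<or> m = 2 * j + 1" by auto
    then show "j \<in> (\<lambda>m. m div 2) ` C" by force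
  qed
  then have "card {j. u j \<noteq> 0} \<le> card C"
    using finC by (meson card_image_le card_mono finite_imageI order_trans)
  moreover have "u j \<in> {- 1, 0, 1}" for j
    using main[of j] zero[of j] by (cases "j < n") (auto simp: power2_eq_1_iff)
  ultimately show "u \<in> B_roots n" using u C2 by (auto simp: B_roots_def)
qed

text \<open>The eigenvalue is multiplicative in the torus element, so it suffices to know it on the
  single factors.\<close>

lemma torus_weight_vectorI:
  assumes x: "cl_supp (2 * n + 1) x" and t: "t \<in> topspace (Euclidean_space n)"
    and factor: "\<And>j s. j < n \<Longrightarrow> cl_mult (2 * n + 1) (torus_factor j s) x =
      (\<lambda>A. cis (u j * s) * cl_mult (2 * n + 1) x (torus_factor j s) A)"
  shows "cl_mult (2 * n + 1) (torus_exp n t) x =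
    (\<lambda>A. cis (pairing n u t) * cl_mult (2 * n + 1) x (torus_exp n t) A)"
  using t
proof (induction rule: torus_exp_induct)
  case zero
  then show ?case using x by (simp add: torus_exp_0 cl_mult_one_left cl_mult_one_right pairing_def)
next
  case (step y j s)
  have "cl_mult (2 * n + 1) (torus_exp n (\<lambda>i. y i + axis j s i)) x =
    cl_mult (2 * n + 1) (torus_exp n y) (\<lambda>A. cis (u j * s) * cl_mult (2 * n + 1) x (torus_factor j s) A)"
    using step(2) by (simp add: torus_exp_axis factor cl_mult_assoc flip: torus_exp_add)
  also have "\<dots> = (\<lambda>A. cis (u j * s) * cl_mult (2 * n + 1) (cl_mult (2 * n + 1) (torus_exp n y) x) (torus_factor j s) A)"
    by (simp add: cl_mult_scale_right cl_mult_assoc)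
  also have "\<dots> = (\<lambda>A. cis (u j * s) * (cis (pairing n u y) *
      cl_mult (2 * n + 1) x (cl_mult (2 * n + 1) (torus_exp n y) (torus_factor j s)) A))"
    unfolding step(1) by (simp add: cl_mult_scale_left cl_mult_assoc)
  finally show ?case using step(2)
    by (simp add: torus_exp_axis pairing_add pairing_axis algebra_simps flip: torus_exp_add cis_mult)
qed

lemma cl_plane_basis_commute:
  assumes "l < n" "m < 2 * n + 1" "m div 2 \<noteq> l"
  shows "cl_mult (2 * n + 1) (cl_plane l) (cl_basis {m}) = cl_mult (2 * n + 1) (cl_basis {m}) (cl_plane l)"
proof -
  have "{2 * l, 2 * l + 1} \<inter> {m} = {}" using assms by auto
  moreover have "{m} \<subseteq> {..<2 * n + 1}" using assms by auto
  ultimately show ?thesis by (subst cl_basis_commute[OF plane_subset[OF assms(1)]]) simp_all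
qed

lemma torus_factor_basis_commute:
  assumes "l < n" "m < 2 * n + 1" "m div 2 \<noteq> l"
  shows "cl_mult (2 * n + 1) (torus_factor l s) (cl_basis {m}) = cl_mult (2 * n + 1) (cl_basis {m}) (torus_factor l s)"
proof -
  have s: "cl_supp (2 * n + 1) (cl_basis {m})" using assms by (intro cl_supp_basis) auto
  show ?thesis unfolding torus_factor_eq cl_mult_lin_left cl_mult_lin_right cl_mult_one_left[OF s]
      cl_mult_one_right[OF s] cl_plane_basis_commute[OF assms] ..
qed

text \<open>The isotropic vector \<open>e (2 * j) - \<i> * \<epsilon> * e (2 * j + 1)\<close>; the factor \<open>1\<close> gives it the shape of
  the linearity rules of \<open>cl_mult\<close>.\<close>

definition weight_vec :: "nat \<Rightarrow> real \<Rightarrow> cliff" where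
  "weight_vec j e = (\<lambda>C. 1 * cl_basis {2 * j} C + (- (\<i> * of_real e)) * cl_basis {2 * j + 1} C)"

lemma cl_supp_weight_vec: "j < n \<Longrightarrow> cl_supp (2 * n + 1) (weight_vec j e)"
  unfolding weight_vec_def by (intro cl_supp_lin cl_supp_basis) auto

text \<open>Multiplying \<open>weight_vec j e\<close> by \<open>cl_plane j\<close> scales it by i *
  e from the left and by -i * e from the right. So the factor acts by opposite half angles on the
  two sides, and their difference is the full angle e * s.\<close>

lemma torus_factor_weight_vec:
  assumes "l < n" "j < n" "e = 1 \<or> e = - 1"
  shows "cl_mult (2 * n + 1) (torus_factor l s) (weight_vec j e) =
    (\<lambda>A. cis (axis j e l * s) * cl_mult (2 * n + 1) (weight_vec j e) (torus_factor l s) A)"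
proof (cases "l = j")
  case False
  then have "cl_mult (2 * n + 1) (torus_factor l s) (cl_basis {2 * j}) = cl_mult (2 * n + 1) (cl_basis {2 * j}) (torus_factor l s)"
    "cl_mult (2 * n + 1) (torus_factor l s) (cl_basis {2 * j + 1}) = cl_mult (2 * n + 1) (cl_basis {2 * j + 1}) (torus_factor l s)"
    by (intro torus_factor_basis_commute; use assms in auto)+
  then show ?thesis using False
    unfolding weight_vec_def cl_mult_lin_left cl_mult_lin_right by (simp add: axis_def)
next
  case True
  let ?N = "2 * n + 1"
  have sub: "{2 * j} \<subseteq> {..<?N}" "{2 * j + 1} \<subseteq> {..<?N}" using assms by auto
  have sd: "sym_diff {2 * j, 2 * j + 1} {2 * j} = {2 * j + 1}" "sym_diff {2 * j, 2 * j + 1} {2 * j + 1} = {2 * j}"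
    "sym_diff {2 * j} {2 * j, 2 * j + 1} = {2 * j + 1}" "sym_diff {2 * j + 1} {2 * j, 2 * j + 1} = {2 * j}" by auto
  have sg: "cl_sign {2 * j, 2 * j + 1} {2 * j} = 1" "cl_sign {2 * j, 2 * j + 1} {2 * j + 1} = - 1"
    "cl_sign {2 * j} {2 * j, 2 * j + 1} = - 1" "cl_sign {2 * j + 1} {2 * j, 2 * j + 1} = 1"
    by (simp_all add: cl_sign_prod)
  note pb = cl_mult_basis[OF plane_subset[OF assms(2)] sub(1)] cl_mult_basis[OF plane_subset[OF assms(2)] sub(2)]
    cl_mult_basis[OF sub(1) plane_subset[OF assms(2)]] cl_mult_basis[OF sub(2) plane_subset[OF assms(2)]]
  have ee: "complex_of_real e * of_real e = 1" using assms(3) by auto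
  have left: "cl_mult ?N (cl_plane j) (weight_vec j e) = (\<lambda>C. (\<i> * of_real e) * weight_vec j e C)"
    unfolding weight_vec_def cl_mult_lin_right pb sd sg by (rule ext) (use ee in \<open>simp add: algebra_simps\<close>)
  have right: "cl_mult ?N (weight_vec j e) (cl_plane j) = (\<lambda>C. (- (\<i> * of_real e)) * weight_vec j e C)"
    unfolding weight_vec_def cl_mult_lin_left pb sd sg by (rule ext) (use ee in \<open>simp add: algebra_simps\<close>)
  have a: "complex_of_real (cos (s / 2)) + of_real (sin (s / 2)) * (\<i> * of_real e) = cis (e * s / 2)"
    "complex_of_real (cos (s / 2)) - of_real (sin (s / 2)) * (\<i> * of_real e) = cis (- (e * s / 2))"
    using assms(3) by (auto simp: complex_eq_iff)
  have "cl_mult ?N (torus_factor j s) (weight_vec j e) = (\<lambda>C. cis (e * s / 2) * weight_vec j e C)"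
    unfolding torus_factor_eq cl_mult_lin_left left cl_mult_one_left[OF cl_supp_weight_vec[OF assms(2)]] a(1)[symmetric]
    by (simp add: algebra_simps)
  moreover have "cl_mult ?N (weight_vec j e) (torus_factor j s) = (\<lambda>C. cis (- (e * s / 2)) * weight_vec j e C)"
    unfolding torus_factor_eq cl_mult_lin_right right cl_mult_one_right[OF cl_supp_weight_vec[OF assms(2)]] a(2)[symmetric]
    by (simp add: algebra_simps)
  ultimately show ?thesis unfolding True by (simp add: axis_def cis_mult flip: mult.assoc)
qed

text \<open>Disjoint index sets make every term a product of two distinct generators, and nothing
  cancels the term at \<open>{a, p}\<close>. The case \<open>d = 0\<close> allows the second vector
  to be a single generator, as short roots require.\<close>

lemma vec_prod_spin_Lie:
  fixes b d :: complex
  assumes "a < N" "a' < N" "p < N" "p' < N" and dis: "{a, a'} \<inter> {p, p'} = {}"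
    and "a \<noteq> a'" "p' \<noteq> p \<or> d = 0"
  defines "X \<equiv> cl_mult N (\<lambda>C. 1 * cl_basis {a} C + b * cl_basis {a'} C) (\<lambda>C. 1 * cl_basis {p} C + d * cl_basis {p'} C)"
  shows "X \<in> spin_Lie N" "X \<noteq> (\<lambda>_. 0)"
proof -
  have sd: "sym_diff {a} {p} = {a, p}" "sym_diff {a} {p'} = {a, p'}" "sym_diff {a'} {p} = {a', p}" "sym_diff {a'} {p'} = {a', p'}"
    using dis by auto
  have sub: "{a} \<subseteq> {..<N}" "{a'} \<subseteq> {..<N}" "{p} \<subseteq> {..<N}" "{p'} \<subseteq> {..<N}" using assms by auto
  have X: "X = (\<lambda>C. 1 * (1 * (cl_sign {a} {p} * cl_basis {a, p} C) + d * (cl_sign {a} {p'} * cl_basis {a, p'} C)) +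
      b * (1 * (cl_sign {a'} {p} * cl_basis {a', p} C) + d * (cl_sign {a'} {p'} * cl_basis {a', p'} C)))"
    unfolding X_def cl_mult_lin_left cl_mult_lin_right cl_mult_basis[OF sub(1,3)] cl_mult_basis[OF sub(1,4)]
      cl_mult_basis[OF sub(2,3)] cl_mult_basis[OF sub(2,4)] sd ..
  have "{a, p} \<noteq> {a', p}" "{a, p} \<noteq> {a', p'}" "{a, p'} = {a, p} \<longleftrightarrow> p' = p"
    using assms by (auto simp: doubleton_eq_iff)
  then have "X {a, p} = cl_sign {a} {p}" unfolding X using assms(7) by (auto simp: cl_basis_def)
  moreover have "cl_sign {a} {p} \<noteq> 0" by (simp add: cl_sign_def)
  ultimately show "X \<noteq> (\<lambda>_. 0)" by metis
  have "A \<subseteq> {..<N} \<and> card A = 2" if "X A \<noteq> 0" for A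
  proof -
    have "A \<in> {{a, p}, {a, p'}, {a', p}, {a', p'}}" using that unfolding X by (auto simp: cl_basis_def split: if_splits)
    then show ?thesis using assms(1-4) dis by auto
  qed
  then show "X \<in> spin_Lie N" by (simp add: spin_Lie_def)
qed

text \<open>Moving the torus element past x and then past y adds their weights. Root vectors thus
  arise as products of vectors of the standard representation.\<close>

lemma weight_vec_prod_root:
  assumes u: "u \<in> topspace (Euclidean_space n)" "u \<noteq> (\<lambda>_. 0)"
    and X: "cl_mult (2 * n + 1) x y \<in> spin_Lie (2 * n + 1)" "cl_mult (2 * n + 1) x y \<noteq> (\<lambda>_. 0)"
    and uvw: "\<And>l. l < n \<Longrightarrow> u l = v l + w l"
    and xv: "\<And>l s. l < n \<Longrightarrow> cl_mult (2 * n + 1) (torus_factor l s) x =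
        (\<lambda>A. cis (v l * s) * cl_mult (2 * n + 1) x (torus_factor l s) A)"
    and yw: "\<And>l s. l < n \<Longrightarrow> cl_mult (2 * n + 1) (torus_factor l s) y =
        (\<lambda>A. cis (w l * s) * cl_mult (2 * n + 1) y (torus_factor l s) A)"
  shows "u \<in> roots n"
proof -
  let ?N = "2 * n + 1"
  have "cl_mult ?N (torus_factor l s) (cl_mult ?N x y) =
      (\<lambda>A. cis (u l * s) * cl_mult ?N (cl_mult ?N x y) (torus_factor l s) A)" if l: "l < n" for l s
  proof -
    have "cl_mult ?N (torus_factor l s) (cl_mult ?N x y) =
        (\<lambda>A. cis (v l * s) * cl_mult ?N x (cl_mult ?N (torus_factor l s) y) A)"
      unfolding cl_mult_assoc[symmetric] xv[OF l] cl_mult_scale_left ..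
    also have "\<dots> = (\<lambda>A. cis (v l * s) * (cis (w l * s) * cl_mult ?N (cl_mult ?N x y) (torus_factor l s) A))"
      unfolding yw[OF l] cl_mult_scale_right cl_mult_assoc ..
    finally show ?thesis by (simp add: uvw[OF l] cis_mult algebra_simps flip: mult.assoc)
  qed
  then have "cl_mult ?N (torus_exp n t) (cl_mult ?N x y) =
     (\<lambda>A. cis (pairing n u t) * cl_mult ?N (cl_mult ?N x y) (torus_exp n t) A)"
    if "t \<in> topspace (Euclidean_space n)" for t
    using that by (intro torus_weight_vectorI) simp_all
  then show ?thesis unfolding roots_def using u X by blast
qed

text \<open>A long root is the sum of the weights of two isotropic vectors. For a short root the
  second vector is e (2 * n), which lies in no plane and has weight 0.\<close>

lemma B_roots_subset: "B_roots n \<subseteq> roots n"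
proof
  fix u assume "u \<in> B_roots n"
  then have u: "u \<in> topspace (Euclidean_space n)" "u \<noteq> (\<lambda>_. 0)" and pm: "\<And>j. u j \<noteq> 0 \<Longrightarrow> u j = 1 \<or> u j = - 1"
    and card: "card {j. u j \<noteq> 0} \<le> 2" by (auto simp: B_roots_def)
  let ?S = "{j. u j \<noteq> 0}"
  have zero: "u j = 0" if "j \<ge> n" for j using u that by (auto simp: topspace_Euclidean_space)
  then have "?S \<subseteq> {..<n}" by (auto simp: not_le[symmetric])
  then have fin: "finite ?S" by (rule finite_subset) simp
  have "?S \<noteq> {}" using u by auto
  then have "card ?S = 1 \<or> card ?S = 2" using fin card by (metis One_nat_def card_0_eq le_SucE le_zero_eq numeral_2_eq_2)
  then show "u \<in> roots n"
  proof
    assume "card ?S = 1"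
    then obtain j where S: "?S = {j}" by (rule card_1_singletonE)
    have j: "j < n" "u j = 1 \<or> u j = - 1" using S zero pm by (auto simp: not_le[symmetric])
    have w0: "cl_mult (2 * n + 1) (torus_factor l s) (cl_basis {2 * n}) =
      (\<lambda>A. cis (0 * s) * cl_mult (2 * n + 1) (cl_basis {2 * n}) (torus_factor l s) A)" if "l < n" for l s
      using that torus_factor_basis_commute[of l n "2 * n"] by simp
    \<comment> \<open>A trivial second term puts the single generator into the two-term form of
      \<open>vec_prod_spin_Lie\<close>.\<close>
    have eq: "cl_basis {2 * n} = (\<lambda>C. 1 * cl_basis {2 * n} C + 0 * cl_basis {2 * n} C)" by simp
    have "cl_mult (2 * n + 1) (weight_vec j (u j)) (cl_basis {2 * n}) \<in> spin_Lie (2 * n + 1)"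
      "cl_mult (2 * n + 1) (weight_vec j (u j)) (cl_basis {2 * n}) \<noteq> (\<lambda>_. 0)"
      unfolding weight_vec_def by (subst eq, rule vec_prod_spin_Lie; use j in auto)+
    then show ?thesis
    proof (rule weight_vec_prod_root[OF u])
      show "u l = axis j (u j) l + 0" if "l < n" for l using S by (auto simp: axis_def)
    qed (use j w0 torus_factor_weight_vec in auto)
  next
    assume "card ?S = 2"
    then obtain j k where S: "?S = {j, k}" and jk: "j \<noteq> k" by (auto simp: card_2_iff)
    have j: "j < n" "u j = 1 \<or> u j = - 1" using S zero pm by (auto simp: not_le[symmetric])
    have k: "k < n" "u k = 1 \<or> u k = - 1" using S zero pm by (auto simp: not_le[symmetric])
    have dis: "{2 * j, 2 * j + 1} \<inter> {2 * k, 2 * k + 1} = {}" using jk by (auto; presburger)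
    have "cl_mult (2 * n + 1) (weight_vec j (u j)) (weight_vec k (u k)) \<in> spin_Lie (2 * n + 1)"
      "cl_mult (2 * n + 1) (weight_vec j (u j)) (weight_vec k (u k)) \<noteq> (\<lambda>_. 0)"
      unfolding weight_vec_def by (rule vec_prod_spin_Lie; use j k dis in simp)+
    then show ?thesis
    proof (rule weight_vec_prod_root[OF u])
      show "u l = axis j (u j) l + axis k (u k) l" if "l < n" for l using S jk by (auto simp: axis_def)
    qed (use j k torus_factor_weight_vec in auto)
  qed
qed

theorem roots_eq: "roots n = B_roots n"
  using roots_subset B_roots_subset by blast

subsection \<open>The Weyl group\<close>

lemma cl_vec_eq: "cl_vec N v = (\<lambda>A. \<Sum>k<N. of_real (v k) * cl_basis {k} A)"
  unfolding cl_vec_def cl_basis_def by (intro ext sum.cong) auto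

lemma cl_mult_sum_left:
  "cl_mult N (\<lambda>A. \<Sum>k<(M::nat). c k * x k A) z = (\<lambda>A. \<Sum>k<M. c k * cl_mult N (x k) z A)"
proof (induction M)
  case 0
  then show ?case by (simp add: cl_mult_coeff fun_eq_iff)
next
  case (Suc M)
  then show ?case using cl_mult_lin_left[of N 1 "\<lambda>A. \<Sum>k<M. c k * x k A" "c M" "x M" z] by simp
qed

lemma cl_mult_sum_right:
  "cl_mult N z (\<lambda>A. \<Sum>k<(M::nat). c k * x k A) = (\<lambda>A. \<Sum>k<M. c k * cl_mult N z (x k) A)"
proof (induction M)
  case 0
  then show ?case by (simp add: cl_mult_coeff fun_eq_iff)
next
  case (Suc M)
  then show ?case using cl_mult_lin_right[of N z 1 "\<lambda>A. \<Sum>k<M. c k * x k A" "c M" "x M"] by simp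
qed

lemma cl_basis_vec_sq: "k < N \<Longrightarrow> cl_mult N (cl_basis {k}) (cl_basis {k}) = (\<lambda>C. - cl_one C)"
  by (subst cl_mult_basis) (simp_all add: cl_sign_prod cl_one_basis)

lemma cl_basis_vec_anticommute:
  "k < N \<Longrightarrow> l < N \<Longrightarrow> k \<noteq> l \<Longrightarrow>
    cl_mult N (cl_basis {k}) (cl_basis {l}) = (\<lambda>C. - cl_mult N (cl_basis {l}) (cl_basis {k}) C)"
  by (subst cl_basis_commute) simp_all

lemma cl_vec_sq:
  assumes "(\<Sum>k<N. (v k)\<^sup>2) = 1"
  shows "cl_mult N (cl_vec N v) (cl_vec N v) = (\<lambda>C. - cl_one C)"
proof
  fix C
  define S where "S = (\<Sum>k<N. \<Sum>l<N. complex_of_real (v k) * of_real (v l) * cl_mult N (cl_basis {k}) (cl_basis {l}) C)"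
  have vv: "cl_mult N (cl_vec N v) (cl_vec N v) C = S"
    unfolding cl_vec_eq cl_mult_sum_left cl_mult_sum_right S_def by (simp add: sum_distrib_left mult.assoc)
  have S2: "S = (\<Sum>k<N. \<Sum>l<N. complex_of_real (v k) * of_real (v l) * cl_mult N (cl_basis {l}) (cl_basis {k}) C)"
    unfolding S_def by (subst sum.swap) (simp add: mult.commute)
  \<comment> \<open>Symmetrizing the double sum brings in anticommutators, which vanish off the
    diagonal.\<close>
  have "S + S = (\<Sum>k<N. \<Sum>l<N. complex_of_real (v k) * of_real (v l) *
      (cl_mult N (cl_basis {k}) (cl_basis {l}) C + cl_mult N (cl_basis {l}) (cl_basis {k}) C))"
    by (subst (2) S2) (simp add: S_def sum.distrib[symmetric] algebra_simps)
  also have "\<dots> = (\<Sum>k<N. \<Sum>l<N. if l = k then - 2 * of_real ((v k)\<^sup>2) * cl_one C else 0)"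
    by (intro sum.cong refl)
      (auto simp: cl_basis_vec_sq power2_eq_square dest: cl_basis_vec_anticommute[THEN fun_cong, of _ _ _ C])
  also have "\<dots> = (\<Sum>k<N. of_real ((v k)\<^sup>2)) * (- 2 * cl_one C)"
    by (simp add: sum_distrib_left sum_distrib_right sum_negf mult_ac)
  also have "\<dots> = - 2 * cl_one C" using assms by (simp only: of_real_sum[symmetric]) simp
  finally show "cl_mult N (cl_vec N v) (cl_vec N v) C = - cl_one C" unfolding vv by simp
qed

lemma cl_supp_vec [simp]: "cl_supp N (cl_vec N v)"
proof -
  have "C \<subseteq> {..<N}" if "cl_vec N v C \<noteq> 0" for C
  proof (rule ccontr)
    assume "\<not> C \<subseteq> {..<N}"
    then have "cl_vec N v C = 0" unfolding cl_vec_def by (intro sum.neutral) auto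
    then show False using that by simp
  qed
  then show ?thesis by (auto simp: cl_supp_def)
qed

text \<open>A unit vector squares to -1, so its negative is its inverse; inverses multiply in the
  reverse order.\<close>

lemma cl_prod_unit_vectors_invertible:
  assumes "\<forall>v\<in>set vs. (\<Sum>k<N. (v k)\<^sup>2) = 1"
  shows "\<exists>h. cl_mult N (cl_prod N (map (cl_vec N) vs)) h = cl_one \<and> cl_mult N h (cl_prod N (map (cl_vec N) vs)) = cl_one"
  using assms
proof (induction vs)
  case Nil
  then show ?case by (auto simp: cl_prod_def intro!: exI[of _ cl_one] cl_mult_one_left)
next
  case (Cons v vs)
  define x where "x = cl_prod N (map (cl_vec N) vs)"
  obtain h where h: "cl_mult N x h = cl_one" "cl_mult N h x = cl_one" using Cons by (auto simp: x_def)
  define v' where "v' = (\<lambda>C. (- 1) * cl_vec N v C)"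
  have v: "cl_mult N (cl_vec N v) v' = cl_one" "cl_mult N v' (cl_vec N v) = cl_one"
    using Cons(2) unfolding v'_def cl_mult_scale_left cl_mult_scale_right by (simp_all add: cl_vec_sq)
  have "cl_supp N v'" using cl_supp_vec[of N v] by (simp add: v'_def cl_supp_def del: cl_supp_vec)
  moreover have "cl_supp N x" by (simp add: x_def)
  ultimately have s: "cl_supp N v'" "cl_supp N x" .
  have p: "cl_prod N (map (cl_vec N) (v # vs)) = cl_mult N (cl_vec N v) x"
    by (simp add: cl_prod_def x_def)
  have "cl_mult N (cl_mult N (cl_vec N v) x) (cl_mult N h v') = cl_mult N (cl_vec N v) (cl_mult N (cl_mult N x h) v')"
    by (simp only: cl_mult_assoc)
  also have "\<dots> = cl_one" unfolding h cl_mult_one_left[OF s(1)] v ..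
  finally have 1: "cl_mult N (cl_mult N (cl_vec N v) x) (cl_mult N h v') = cl_one" .
  have "cl_mult N (cl_mult N h v') (cl_mult N (cl_vec N v) x) = cl_mult N h (cl_mult N (cl_mult N v' (cl_vec N v)) x)"
    by (simp only: cl_mult_assoc)
  also have "\<dots> = cl_one" unfolding v cl_mult_one_left[OF s(2)] h ..
  finally show ?case using 1 unfolding p by blast
qed

text \<open>With P the product so far and c the new cosine, 1 - P * c = (1 - P) + P * (1 - c). Since
  P tends to 1, the new factor contributes the limit of (1 - c) / s^2, which the half-angle formula
  gives.\<close>

lemma tendsto_one_minus_prod_cos:
  "((\<lambda>s. (1 - (\<Prod>j<(n::nat). cos (s * a j))) / s\<^sup>2) \<longlongrightarrow> (\<Sum>j<n. (a j)\<^sup>2) / 2) (at (0::real))"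
proof (induction n)
  case 0
  then show ?case by simp
next
  case (Suc n)
  have "DERIV (\<lambda>s. sin (s * a n / 2)) 0 :> a n / 2" by (auto intro!: derivative_eq_intros)
  then have "((\<lambda>s. sin (s * a n / 2) / s) \<longlongrightarrow> a n / 2) (at 0)" by (simp add: DERIV_def)
  then have "((\<lambda>s. 2 * (sin (s * a n / 2) / s)\<^sup>2) \<longlongrightarrow> 2 * (a n / 2)\<^sup>2) (at 0)"
    by (intro tendsto_mult tendsto_const tendsto_power)
  moreover have "2 * (sin (s * a n / 2) / s)\<^sup>2 = (1 - cos (s * a n)) / s\<^sup>2" for s
    using cos_double_sin[of "s * a n / 2"] by (simp add: power_divide)
  moreover have "2 * (a n / 2)\<^sup>2 = (a n)\<^sup>2 / 2" by (simp add: power_divide)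
  ultimately have c: "((\<lambda>s. (1 - cos (s * a n)) / s\<^sup>2) \<longlongrightarrow> (a n)\<^sup>2 / 2) (at 0)"
    by (simp only:)
  have "((\<lambda>s. \<Prod>j<n. cos (s * a j)) \<longlongrightarrow> (\<Prod>j<n. cos (0 * a j))) (at 0)" by (intro tendsto_intros)
  then have "((\<lambda>s. (1 - (\<Prod>j<n. cos (s * a j))) / s\<^sup>2 + (\<Prod>j<n. cos (s * a j)) * ((1 - cos (s * a n)) / s\<^sup>2))
     \<longlongrightarrow> (\<Sum>j<n. (a j)\<^sup>2) / 2 + 1 * ((a n)\<^sup>2 / 2)) (at 0)"
    by (intro tendsto_add tendsto_mult Suc c) simp
  moreover have "(1 - P) / s\<^sup>2 + P * ((1 - c) / s\<^sup>2) = (1 - P * c) / s\<^sup>2" for P c s :: real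
    by (simp add: add_divide_distrib[symmetric] algebra_simps)
  ultimately show ?case by (simp add: add_divide_distrib)
qed

lemma prod_cos_eq_imp:
  assumes "\<And>s. (\<Prod>j<(n::nat). cos (s * a j)) = (\<Prod>j<n. cos (s * b j :: real))"
  shows "(\<Sum>j<n. (a j)\<^sup>2) = (\<Sum>j<n. (b j)\<^sup>2)"
  using LIM_unique[OF tendsto_one_minus_prod_cos[of a n] tendsto_one_minus_prod_cos[of b n, folded assms]]
  by simp

text \<open>The trace of the spin representation at \<open>exp t\<close> is a multiple of the product of the \<open>cos (t j / 2)\<close>,
  whose second order part at \<open>t = 0\<close> is the standard quadratic form.\<close>

lemma weyl_group_isometry:
  assumes w: "w \<in> weyl_group n" and t: "t \<in> topspace (Euclidean_space n)"
  shows "(\<Sum>j<n. (\<Sum>k<n. w j k * t k)\<^sup>2) = (\<Sum>j<n. (t j)\<^sup>2)"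
proof -
  obtain g where g: "g \<in> Spin (2 * n + 1)"
    and eq: "\<And>t. t \<in> topspace (Euclidean_space n) \<Longrightarrow> cl_mult (2 * n + 1) g (torus_exp n t) =
     cl_mult (2 * n + 1) (torus_exp n (\<lambda>j. if j < n then \<Sum>k<n. w j k * t k else 0)) g"
    using w by (auto simp: weyl_group_def)
  obtain h where h: "cl_mult (2 * n + 1) g h = cl_one" "cl_mult (2 * n + 1) h g = cl_one"
    using g cl_prod_unit_vectors_invertible by (fastforce simp: Spin_def)
  \<comment> \<open>Applied at the parameter 2 * s * t, whose half angles are s * t j; both scalar
    parts agree because g conjugates one torus element into the other.\<close>
  have "(\<Prod>j<n. cos (s * (2 * t j) / 2 )) = (\<Prod>j<n. cos (s * (2 * (\<Sum>k<n. w j k * t k)) / 2))" for s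
  proof -
    have st: "(\<lambda>j. 2 * s * t j) \<in> topspace (Euclidean_space n)" using t by (auto simp: topspace_Euclidean_space)
    have "(\<Sum>k<n. w j k * (2 * s * t k)) = 2 * s * (\<Sum>k<n. w j k * t k)" for j
      by (simp add: sum_distrib_left mult_ac)
    then show ?thesis
      using scalar_part_conj[OF eq[OF st] h cl_supp_torus_exp cl_supp_torus_exp]
      unfolding torus_exp_scalar_part of_real_eq_iff by (simp add: mult_ac)
  qed
  then show ?thesis by (intro prod_cos_eq_imp[symmetric]) simp
qed

text \<open>With \<open>G = W\<^sup>T W = 1\<close> and \<open>R = W W\<^sup>T\<close>, the squared Frobenius norm of \<open>R - 1\<close> is
  \<open>tr (G\<^sup>2) - 2 tr G + n = 0\<close>.\<close>

lemma orthonormal_columns_imp_rows: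
  fixes w :: "nat \<Rightarrow> nat \<Rightarrow> real"
  assumes G: "\<And>k l. k < n \<Longrightarrow> l < n \<Longrightarrow> (\<Sum>j<n. w j k * w j l) = (if k = l then 1 else 0)"
    and ij: "i < n" "j < n"
  shows "(\<Sum>k<n. w i k * w j k) = (if i = j then 1 else 0)"
proof -
  define R where "R i j = (\<Sum>k<n. w i k * w j k)" for i j
  have "(\<Sum>i<n. \<Sum>j<n. (R i j)\<^sup>2) = (\<Sum>i<n. \<Sum>j<n. \<Sum>k<n. \<Sum>l<n. w i k * w j k * (w i l * w j l))"
    by (simp add: R_def power2_eq_square sum_product)
  also have "\<dots> = (\<Sum>i<n. \<Sum>k<n. \<Sum>l<n. \<Sum>j<n. w i k * w j k * (w i l * w j l))"
    by (rule sum.cong[OF refl], subst sum.swap, rule sum.cong[OF refl], rule sum.swap)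
  also have "\<dots> = (\<Sum>i<n. \<Sum>k<n. \<Sum>l<n. w i k * w i l * (\<Sum>j<n. w j k * w j l))"
    by (simp add: sum_distrib_left mult_ac)
  also have "\<dots> = (\<Sum>i<n. \<Sum>k<n. \<Sum>l<n. if k = l then w i k * w i k else 0)"
    by (intro sum.cong refl) (simp add: G)
  also have "\<dots> = (\<Sum>i<n. \<Sum>k<n. w i k * w i k)" by simp
  also have "\<dots> = (\<Sum>k<n. \<Sum>i<n. w i k * w i k)" by (rule sum.swap)
  also have "\<dots> = n" by (simp add: G)
  finally have RR: "(\<Sum>i<n. \<Sum>j<n. (R i j)\<^sup>2) = n" .
  have "(\<Sum>i<n. R i i) = (\<Sum>k<n. \<Sum>i<n. w i k * w i k)" unfolding R_def by (rule sum.swap)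
  then have tr: "(\<Sum>i<n. R i i) = n" by (simp add: G)
  have "(\<Sum>i<n. \<Sum>j<n. (R i j - (if i = j then 1 else 0))\<^sup>2) =
    (\<Sum>i<n. \<Sum>j<n. (R i j)\<^sup>2 + (if i = j then 1 - 2 * R i j else 0))"
    by (intro sum.cong refl) (auto simp: power2_eq_square algebra_simps)
  also have "\<dots> = (\<Sum>i<n. \<Sum>j<n. (R i j)\<^sup>2) + (\<Sum>i<n. 1 - 2 * R i i)"
    by (simp add: sum.distrib)
  also have "\<dots> = 0" unfolding RR sum_subtractf sum_distrib_left[symmetric] tr by simp
  finally have "(R i j - (if i = j then 1 else 0))\<^sup>2 = 0"
    using ij by (simp add: sum_nonneg_eq_0_iff sum_nonneg)
  then show ?thesis by (simp add: R_def)
qed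

text \<open>The isometry property at the axes and at sums of two axes makes the columns of w
  orthonormal. The action on linear forms is by the transposed matrix, so it is the rows that have
  to be orthonormal.\<close>

lemma weyl_act_pairing:
  assumes w: "w \<in> weyl_group n"
  shows "pairing n (weyl_act n w x) (weyl_act n w y) = pairing n x y"
proof -
  define G where "G k l = (\<Sum>j<n. w j k * w j l)" for k l
  have quad: "(\<Sum>j<n. (w j k * a + w j l * b)\<^sup>2) = G k k * a\<^sup>2 + 2 * G k l * (a * b) + G l l * b\<^sup>2" for k l a b
    unfolding G_def by (simp add: power2_eq_square sum_distrib_left sum_distrib_right sum.distrib[symmetric] algebra_simps)
  have ax: "(\<Sum>k<n. f k * axis m a k) = f m * a" if "m < n" for f :: "nat \<Rightarrow> real" and m a
    using pairing_axis[OF that, of f a] by (simp add: pairing_def)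
  have Gkk: "G k k = 1" if "k < n" for k
    using weyl_group_isometry[OF w axis_topspace[OF that, of 1]] ax[OF that] quad[of k 1 k 0]
      ax[OF that, of "axis k 1" 1] by (simp add: power2_eq_square axis_def)
  have Gkl: "G k l = 0" if "k < n" "l < n" "k \<noteq> l" for k l
  proof -
    have top: "(\<lambda>j. axis k 1 j + axis l 1 j) \<in> topspace (Euclidean_space n)"
      using that by (auto simp: axis_def topspace_Euclidean_space)
    have "(\<Sum>j<n. (axis k 1 j + axis l 1 j)\<^sup>2) = (\<Sum>j<n. axis k 1 j + axis l 1 j)"
      using that(3) by (intro sum.cong) (auto simp: axis_def)
    also have "\<dots> = 2" using that by (simp add: sum.distrib axis_def)
    finally have "(\<Sum>j<n. (w j k * 1 + w j l * 1)\<^sup>2) = 2"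
      using weyl_group_isometry[OF w top] that by (simp add: distrib_left sum.distrib ax)
    then show ?thesis unfolding quad using Gkk that by simp
  qed
  have R: "(\<Sum>k<n. w i k * w j k) = (if i = j then 1 else 0)" if "i < n" "j < n" for i j
  proof (rule orthonormal_columns_imp_rows[OF _ that])
    show "(\<Sum>j<n. w j k * w j l) = (if k = l then 1 else 0)" if "k < n" "l < n" for k l
      unfolding G_def[symmetric] using Gkk Gkl that by simp
  qed
  have "pairing n (weyl_act n w x) (weyl_act n w y) = (\<Sum>k<n. (\<Sum>i<n. x i * w i k) * (\<Sum>j<n. y j * w j k))"
    by (simp add: pairing_def weyl_act_def)
  also have "\<dots> = (\<Sum>k<n. \<Sum>i<n. \<Sum>j<n. x i * y j * (w i k * w j k))"
    by (simp add: sum_product mult_ac)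
  also have "\<dots> = (\<Sum>i<n. \<Sum>j<n. \<Sum>k<n. x i * y j * (w i k * w j k))"
    by (subst sum.swap, rule sum.cong[OF refl], rule sum.swap)
  also have "\<dots> = (\<Sum>i<n. \<Sum>j<n. if i = j then x i * y i else 0)"
    unfolding sum_distrib_left[symmetric] by (intro sum.cong refl) (simp add: R)
  also have "\<dots> = pairing n x y" by (simp add: pairing_def)
  finally show ?thesis .
qed

subsection \<open>The basic inner product\<close>

text \<open>As a matrix it maps the k-th standard basis vector to \<open>\<epsilon> k\<close> times
  the \<open>\<sigma> k\<close>-th.\<close>

definition signed_perm :: "(nat \<Rightarrow> nat) \<Rightarrow> (nat \<Rightarrow> real) \<Rightarrow> nat \<Rightarrow> nat \<Rightarrow> real" where
  "signed_perm \<sigma> \<epsilon> = (\<lambda>j k. if j = \<sigma> k then \<epsilon> k else 0)"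

lemma weyl_act_signed_perm:
  assumes "\<And>k. k < n \<Longrightarrow> \<sigma> k < n"
  shows "weyl_act n (signed_perm \<sigma> \<epsilon>) l = (\<lambda>k. if k < n then l (\<sigma> k) * \<epsilon> k else 0)"
  using assms by (auto simp: weyl_act_def signed_perm_def if_distrib cong: if_cong)

text \<open>Cosine is even and sine odd, so a sign on the plane element becomes a sign on the angle:
  g carries the factor k at s to the factor \<open>\<sigma> k\<close> at
  \<open>\<epsilon> k * s\<close>.\<close>

lemma signed_perm_in_weyl_group:
  assumes g: "g \<in> Spin (2 * n + 1)"
    and perm: "\<And>k. k < n \<Longrightarrow> \<sigma> k < n"
    and sgn: "\<And>k. k < n \<Longrightarrow> \<epsilon> k = 1 \<or> \<epsilon> k = - 1"
    and conj: "\<And>k. k < n \<Longrightarrow> cl_mult (2 * n + 1) g (cl_plane k) =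
      (\<lambda>C. of_real (\<epsilon> k) * cl_mult (2 * n + 1) (cl_plane (\<sigma> k)) g C)"
  shows "signed_perm \<sigma> \<epsilon> \<in> weyl_group n"
proof -
  let ?N = "2 * n + 1"
  let ?w = "\<lambda>t j. if j < n then \<Sum>k<n. signed_perm \<sigma> \<epsilon> j k * t k else 0"
  have supp: "cl_supp ?N g" using g by (auto simp: Spin_def)
  have factor: "cl_mult ?N g (torus_factor k s) = cl_mult ?N (torus_factor (\<sigma> k) (\<epsilon> k * s)) g"
    if "k < n" for k s
  proof -
    have "cos (\<epsilon> k * s / 2) = cos (s / 2)" "sin (\<epsilon> k * s / 2) = \<epsilon> k * sin (s / 2)"
      using sgn[OF that] by auto
    then show ?thesis
      unfolding torus_factor_eq cl_mult_lin_left cl_mult_lin_right cl_mult_one_left[OF supp]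
        cl_mult_one_right[OF supp] conj[OF that] by (simp add: mult_ac)
  qed
  have "cl_mult ?N g (torus_exp n t) = cl_mult ?N (torus_exp n (?w t)) g"
    if "t \<in> topspace (Euclidean_space n)" for t
    using that
  proof (induction rule: torus_exp_induct)
    case zero
    then show ?case using supp torus_exp_0 by (simp add: cl_mult_one_left cl_mult_one_right cong: if_cong)
  next
    case (step t k s)
    have ax: "axis (\<sigma> k) (\<epsilon> k * s) j = (\<Sum>i<n. signed_perm \<sigma> \<epsilon> j i * axis k s i)" for j
    proof -
      have "signed_perm \<sigma> \<epsilon> j i * axis k s i = (if i = k then axis (\<sigma> k) (\<epsilon> k * s) j else 0)" for i
        by (simp add: signed_perm_def axis_def)
      then show ?thesis using step(2) by simp
    qed
    have w: "?w (\<lambda>i. t i + axis k s i) = (\<lambda>j. ?w t j + axis (\<sigma> k) (\<epsilon> k * s) j)"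
    proof
      fix j show "?w (\<lambda>i. t i + axis k s i) j = ?w t j + axis (\<sigma> k) (\<epsilon> k * s) j"
      proof (cases "j < n")
        case True
        then show ?thesis by (simp add: ax distrib_left sum.distrib)
      next
        case False
        then show ?thesis using perm[OF step(2)] by (simp add: axis_def)
      qed
    qed
    have "cl_mult ?N g (torus_exp n (\<lambda>i. t i + axis k s i)) =
        cl_mult ?N (cl_mult ?N g (torus_exp n t)) (torus_factor k s)"
      using step(2) by (simp add: cl_mult_assoc torus_exp_axis flip: torus_exp_add)
    also have "\<dots> = cl_mult ?N (cl_mult ?N (torus_exp n (?w t)) (torus_factor (\<sigma> k) (\<epsilon> k * s))) g"
      unfolding step(1) using factor[OF step(2), of s] by (simp add: cl_mult_assoc)
    also have "\<dots> = cl_mult ?N (torus_exp n (?w (\<lambda>i. t i + axis k s i))) g"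
      unfolding w torus_exp_add[symmetric] torus_exp_axis[OF perm[OF step(2)]] ..
    finally show ?case .
  qed
  then show ?thesis unfolding weyl_group_def using g by blast
qed

lemma Spin_mult_vectors:
  assumes "v \<in> topspace (Euclidean_space N)" "w \<in> topspace (Euclidean_space N)"
    "(\<Sum>k<N. (v k)\<^sup>2) = 1" "(\<Sum>k<N. (w k)\<^sup>2) = 1"
  shows "cl_mult N (cl_vec N v) (cl_vec N w) \<in> Spin N"
proof -
  have "cl_prod N (map (cl_vec N) [v, w]) = cl_mult N (cl_vec N v) (cl_vec N w)"
    by (simp add: cl_prod_def cl_mult_one_right)
  moreover have "even (length [v, w])" "\<forall>x\<in>set [v, w]. x \<in> topspace (Euclidean_space N) \<and> (\<Sum>k<N. (x k)\<^sup>2) = 1"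
    using assms by auto
  ultimately show ?thesis unfolding Spin_def by (intro CollectI exI[of _ "[v, w]"] conjI) simp_all
qed

text \<open>Conjugation by \<open>g\<close> negates e (2 * j + 1), which reverses the rotation in
  plane j, and e (2 * n), which belongs to no plane. The odd dimension supplies this spare vector,
  needed since \<open>Spin\<close> has only even products.\<close>

lemma flip_in_weyl_group:
  assumes j: "j < n"
  shows "signed_perm (\<lambda>k. k) (\<lambda>k. if k = j then - 1 else 1) \<in> weyl_group n"
proof -
  let ?N = "2 * n + 1"
  have vec: "cl_vec ?N (axis m 1) = cl_basis {m}" if "m < ?N" for m
    using that by (auto simp: cl_vec_eq axis_def fun_eq_iff if_distribR if_distrib cong: if_cong)
  have norm: "(\<Sum>k<?N. (axis m 1 k)\<^sup>2) = 1" if "m < ?N" for m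
    using that by (simp add: axis_def if_distribR if_distrib cong: if_cong)
  have lt: "2 * j + 1 < ?N" "2 * n < ?N" using j by auto
  define g where "g = cl_mult ?N (cl_basis {2 * j + 1}) (cl_basis {2 * n})"
  have "g \<in> Spin ?N"
    unfolding g_def vec[OF lt(1), symmetric] vec[OF lt(2), symmetric]
    by (rule Spin_mult_vectors) (use lt axis_topspace norm in blast)+
  moreover have "cl_mult ?N g (cl_plane k) =
      (\<lambda>C. of_real (if k = j then - 1 else 1) * cl_mult ?N (cl_plane k) g C)" if k: "k < n" for k
  proof -
    let ?A = "{2 * j + 1, 2 * n}"
    have sub: "?A \<subseteq> {..<?N}" using lt by auto
    have "sym_diff {2 * j + 1} {2 * n} = ?A" using j by auto
    then have g: "g = (\<lambda>C. cl_sign {2 * j + 1} {2 * n} * cl_basis ?A C)"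
      unfolding g_def using lt by (subst cl_mult_basis) auto
    \<comment> \<open>Both sets have two elements, so the commutation sign depends only on the size
      of their intersection.\<close>
    have "?A \<inter> {2 * k, 2 * k + 1} = (if k = j then {2 * j + 1} else {})"
      using k by (auto; presburger)
    moreover have "card ?A = 2" 
    proof -
      have "2 * j + 1 \<noteq> 2 * n" by presburger
      then show ?thesis by simp
    qed
    ultimately have "cl_mult ?N (cl_basis ?A) (cl_plane k) =
        (\<lambda>C. (if k = j then - 1 else 1) * cl_mult ?N (cl_plane k) (cl_basis ?A) C)"
      by (subst cl_basis_commute[OF sub plane_subset[OF k]]) simp
    then show ?thesis unfolding g cl_mult_scale_left cl_mult_scale_right by (simp add: mult_ac)
  qed
  ultimately show ?thesis by (intro signed_perm_in_weyl_group) auto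
qed

text \<open>A multiple of e a - e b induces the reflection that exchanges e a and e b, up to the
  sign -1 by which orthogonal vectors anticommute.\<close>

lemma reflection_basis_vec:
  fixes a b :: nat and c :: complex
  defines "r \<equiv> (\<lambda>C. c * cl_basis {a} C + (- c) * cl_basis {b} C)"
    and "k' \<equiv> \<lambda>k. if k = a then b else if k = b then a else k"
  assumes lt: "a < N" "b < N" "k < N" and ab: "a \<noteq> b"
  shows "cl_mult N r (cl_basis {k}) = (\<lambda>C. (- 1) * cl_mult N (cl_basis {k' k}) r C)"
proof -
  note sq = cl_basis_vec_sq[OF lt(1)] cl_basis_vec_sq[OF lt(2)]
  consider "k = a" | "k = b" | "k \<noteq> a" "k \<noteq> b" by blast
  then show ?thesis
  proof cases
    case 1
    then show ?thesis using ab unfolding r_def cl_mult_lin_left cl_mult_lin_right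
      by (simp add: sq k'_def fun_eq_iff)
  next
    case 2
    then show ?thesis using ab unfolding r_def cl_mult_lin_left cl_mult_lin_right
      by (simp add: sq k'_def fun_eq_iff)
  next
    case 3
    then show ?thesis using ab unfolding r_def cl_mult_lin_left cl_mult_lin_right
      using cl_basis_vec_anticommute[OF lt(1,3)] cl_basis_vec_anticommute[OF lt(2,3)] by (simp add: k'_def)
  qed
qed

lemma cl_plane_mult: "k < n \<Longrightarrow> cl_plane k = cl_mult (2 * n + 1) (cl_basis {2 * k}) (cl_basis {2 * k + 1})"
proof -
  assume "k < n"
  moreover have "sym_diff {2 * k} {2 * k + 1} = {2 * k, 2 * k + 1}" by auto
  moreover have "cl_sign {2 * k} {2 * k + 1} = 1" by (simp add: cl_sign_prod)
  ultimately show ?thesis by (subst cl_mult_basis) auto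
qed

text \<open>The product of the reflections along e (2 * i) - e (2 * j) and e (2 * i + 1) - e (2 * j
  + 1) exchanges the two planes with their orientation. Its two factors make the signs -1 cancel and
  put it into \<open>Spin\<close>.\<close>

lemma swap_in_weyl_group:
  assumes ij: "i < n" "j < n" "i \<noteq> j"
  shows "signed_perm (\<lambda>k. if k = i then j else if k = j then i else k) (\<lambda>_. 1) \<in> weyl_group n"
proof -
  let ?N = "2 * n + 1"
  let ?\<pi> = "\<lambda>a b k. if k = a then b else if k = b then a else k"
  \<comment> \<open>The factor 1 / sqrt 2 normalizes e a - e b to length 1.\<close>
  define v where "v a b = (\<lambda>m. if m = a then 1 / sqrt 2 else if m = b then - 1 / sqrt 2 else 0)" for a b :: nat
  define r where "r a b = cl_vec ?N (v a b)" for a b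
  have r: "r a b = (\<lambda>C. of_real (1 / sqrt 2) * cl_basis {a} C + (- of_real (1 / sqrt 2)) * cl_basis {b} C)"
    if "a < ?N" "b < ?N" "a \<noteq> b" for a b
  proof
    fix C
    have "complex_of_real (v a b m) * cl_basis {m} C = (if m = a then of_real (1 / sqrt 2) * cl_basis {a} C else 0) +
       (if m = b then (- of_real (1 / sqrt 2)) * cl_basis {b} C else 0)" for m
      using that by (auto simp: v_def)
    then show "r a b C = of_real (1 / sqrt 2) * cl_basis {a} C + (- of_real (1 / sqrt 2)) * cl_basis {b} C"
      using that by (simp add: r_def cl_vec_eq sum.distrib)
  qed
  have norm: "(\<Sum>k<?N. (v a b k)\<^sup>2) = 1" if "a < ?N" "b < ?N" "a \<noteq> b" for a b
  proof -
    have "(v a b k)\<^sup>2 = (if k = a then 1 / 2 else 0) + (if k = b then 1 / 2 else 0)" for k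
      using that by (auto simp: v_def power_divide)
    then show ?thesis using that by (simp add: sum.distrib)
  qed
  have top: "v a b \<in> topspace (Euclidean_space ?N)" if "a < ?N" "b < ?N" for a b
    using that by (auto simp: v_def topspace_Euclidean_space)
  have lt: "2 * i < ?N" "2 * j < ?N" "2 * i \<noteq> 2 * j" "2 * i + 1 < ?N" "2 * j + 1 < ?N" "2 * i + 1 \<noteq> 2 * j + 1"
    using ij by auto
  define g where "g = cl_mult ?N (r (2 * i) (2 * j)) (r (2 * i + 1) (2 * j + 1))"
  have "g \<in> Spin ?N" unfolding g_def r_def
    by (intro Spin_mult_vectors top norm) (use lt in auto)
  moreover have "cl_mult ?N g (cl_plane k) = (\<lambda>C. of_real 1 * cl_mult ?N (cl_plane (?\<pi> i j k)) g C)" if k: "k < n" for k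
  proof -
    define \<tau> where "\<tau> m = ?\<pi> (2 * i) (2 * j) (?\<pi> (2 * i + 1) (2 * j + 1) m)" for m
    have refl: "cl_mult ?N (r a b) (cl_basis {m}) = (\<lambda>C. (- 1) * cl_mult ?N (cl_basis {?\<pi> a b m}) (r a b) C)"
      if "a < ?N" "b < ?N" "a \<noteq> b" "m < ?N" for a b m
      unfolding r[OF that(1-3)] by (rule reflection_basis_vec) (use that in auto)
    have g_vec: "cl_mult ?N g (cl_basis {m}) = cl_mult ?N (cl_basis {\<tau> m}) g" if m: "m < ?N" for m
    proof -
      have m': "?\<pi> (2 * i + 1) (2 * j + 1) m < ?N" using m lt by auto
      have "cl_mult ?N g (cl_basis {m}) =
        (\<lambda>C. (- 1) * cl_mult ?N (cl_mult ?N (r (2 * i) (2 * j)) (cl_basis {?\<pi> (2 * i + 1) (2 * j + 1) m})) (r (2 * i + 1) (2 * j + 1)) C)"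
        unfolding g_def cl_mult_assoc refl[OF lt(4-6) m] cl_mult_scale_right ..
      also have "\<dots> = cl_mult ?N (cl_basis {\<tau> m}) g"
        unfolding refl[OF lt(1-3) m'] cl_mult_scale_left \<tau>_def[symmetric] g_def cl_mult_assoc by simp
      finally show ?thesis .
    qed
    have \<tau>: "\<tau> (2 * k) = 2 * ?\<pi> i j k" "\<tau> (2 * k + 1) = 2 * ?\<pi> i j k + 1"
      unfolding \<tau>_def by (auto; presburger)+
    have k': "?\<pi> i j k < n" using k ij by simp
    have "cl_mult ?N g (cl_plane k) = cl_mult ?N (cl_mult ?N (cl_basis {2 * ?\<pi> i j k}) g) (cl_basis {2 * k + 1})"
      unfolding cl_plane_mult[OF k] cl_mult_assoc[symmetric] using k by (subst g_vec) (auto simp: \<tau>)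
    also have "\<dots> = cl_mult ?N (cl_basis {2 * ?\<pi> i j k}) (cl_mult ?N (cl_basis {2 * ?\<pi> i j k + 1}) g)"
      unfolding cl_mult_assoc using k by (subst g_vec) (auto simp: \<tau>)
    also have "\<dots> = cl_mult ?N (cl_plane (?\<pi> i j k)) g"
      unfolding cl_plane_mult[OF k'] cl_mult_assoc ..
    finally show ?thesis by simp
  qed
  ultimately show ?thesis using ij by (intro signed_perm_in_weyl_group) auto
qed

text \<open>Every nonzero entry has square 1, so the squared length is the size of the
  support.\<close>

lemma B_roots_norm_le:
  assumes "u \<in> B_roots n"
  shows "pairing n u u \<le> 2"
proof -
  have pm: "u j = 0 \<or> u j * u j = 1" for j using assms 
  proof -
    have "u j \<in> {- 1, 0, 1}" using assms by (auto simp: B_roots_def)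
    then show ?thesis by auto
  qed
  have "{j. u j \<noteq> 0} \<subseteq> {..<n}" using assms by (auto simp: B_roots_def topspace_Euclidean_space not_le[symmetric])
  then have S: "{j. u j \<noteq> 0} = {..<n} \<inter> {j. u j \<noteq> 0}" by blast
  have "pairing n u u = (\<Sum>j<n. if u j \<noteq> 0 then 1 else 0)"
    unfolding pairing_def by (rule sum.cong) (use pm in auto)
  also have "\<dots> = card {j. u j \<noteq> 0}" by (subst S) (simp add: sum.If_cases)
  finally show ?thesis using assms by (simp add: B_roots_def)
qed

definition B_theta :: "nat \<Rightarrow> real" where
  "B_theta = (\<lambda>j. if j < 2 then 1 else 0)"

lemma B_theta_root: "n > 1 \<Longrightarrow> B_theta \<in> B_roots n"
proof -
  assume "n > 1"
  moreover have "{j. B_theta j \<noteq> 0} = {..<2}" by (auto simp: B_theta_def)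
  moreover have "B_theta \<noteq> (\<lambda>_. 0)" by (auto simp: B_theta_def dest!: fun_cong[of _ _ 0])
  moreover have "\<forall>j\<ge>n. B_theta j = 0" "\<forall>j. B_theta j \<in> {- 1, 0, 1}"
    using \<open>n > 1\<close> by (simp_all add: B_theta_def)
  ultimately show ?thesis by (simp add: B_roots_def topspace_Euclidean_space)
qed

lemma pairing_theta: "n > 1 \<Longrightarrow> pairing n B_theta x = x 0 + x 1"
proof -
  assume "n > 1"
  then have S: "{..<2} \<subseteq> {..<n}" by auto
  have "pairing n B_theta x = (\<Sum>j<2. x j)"
    unfolding pairing_def by (rule sum.mono_neutral_cong_right) (use S in \<open>auto simp: B_theta_def\<close>)
  then show ?thesis by (simp add: numeral_2_eq_2 One_nat_def)
qed

lemma pairing_basic: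
  assumes "n > 1"
  shows "is_basic_inner_product n (pairing n)"
proof -
  have pos: "pairing n x x > 0" if x: "x \<in> topspace (Euclidean_space n)" "x \<noteq> (\<lambda>_. 0)" for x
  proof -
    obtain j where j: "x j \<noteq> 0" using x by auto
    then have "j < n" using x by (auto simp: topspace_Euclidean_space not_le[symmetric])
    then show ?thesis unfolding pairing_def
      using j by (intro sum_pos2[of _ j]) (auto simp: zero_less_mult_iff)
  qed
  have "pairing n (\<lambda>j. a * x j + b * y j) z = a * pairing n x z + b * pairing n y z" for a b x y z
    by (simp add: pairing_def sum_distrib_left sum.distrib algebra_simps)
  moreover have "pairing n x y = pairing n y x" for x y by (simp add: pairing_def mult.commute)
  ultimately have "is_inner_product n (pairing n)" using pos by (auto simp: is_inner_product_def)
  \<comment> \<open>The bound 2 on squared lengths is attained by \<open>B_theta\<close>, so it is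
    the value at every longest root.\<close>
  moreover have "pairing n u u = 2" if "u \<in> roots n" "\<forall>v\<in>roots n. pairing n v v \<le> pairing n u u" for u
  proof -
    have "pairing n B_theta B_theta \<le> pairing n u u" using that B_theta_root[OF assms] by (simp add: roots_eq)
    then have "2 \<le> pairing n u u" using pairing_theta[OF assms, of B_theta] by (simp add: B_theta_def)
    then show ?thesis using B_roots_norm_le[of u n] that by (simp add: roots_eq)
  qed
  ultimately show ?thesis unfolding is_basic_inner_product_def using weyl_act_pairing by blast
qed

text \<open>A sign change makes distinct axes orthogonal, and transpositions give all axes the same
  square c. So the form is c times the standard one, and the long root \<open>B_theta\<close> yields
  2 * c = 2.\<close>

lemma basic_inner_product_unique:
  assumes n: "n > 1" and ip: "is_basic_inner_product n ip"
    and x: "x \<in> topspace (Euclidean_space n)" and y: "y \<in> topspace (Euclidean_space n)"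
  shows "ip x y = pairing n x y"
proof -
  let ?E = "topspace (Euclidean_space n)"
  have sym: "ip x y = ip y x" if "x \<in> ?E" "y \<in> ?E" for x y
    using ip that by (auto simp: is_basic_inner_product_def is_inner_product_def)
  have lin: "ip (\<lambda>j. a * x j + b * y j) z = a * ip x z + b * ip y z" if "x \<in> ?E" "y \<in> ?E" "z \<in> ?E" for a b x y z
    using ip that by (simp add: is_basic_inner_product_def is_inner_product_def)
  have inv: "ip (weyl_act n w x) (weyl_act n w y) = ip x y" if "w \<in> weyl_group n" "x \<in> ?E" "y \<in> ?E" for w x y
    using ip that by (auto simp: is_basic_inner_product_def)
  have pos: "ip x x > 0" if "x \<in> ?E" "x \<noteq> (\<lambda>_. 0)" for x
    using ip that by (auto simp: is_basic_inner_product_def is_inner_product_def)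
  define c where "c = ip (axis 0 1) (axis 0 1)"
  have orth: "ip (axis i 1) (axis j 1) = 0" if ij: "i < n" "j < n" "i \<noteq> j" for i j
  proof -
    let ?w = "signed_perm (\<lambda>k. k) (\<lambda>k. if k = i then - 1 else 1)"
    have "weyl_act n ?w (axis i 1) = (\<lambda>k. (- 1) * axis i 1 k + 0 * axis i 1 k)" "weyl_act n ?w (axis j 1) = axis j 1"
      using ij by (auto simp: weyl_act_signed_perm axis_def)
    then have "- ip (axis i 1) (axis j 1) = ip (axis i 1) (axis j 1)"
      using inv[OF flip_in_weyl_group[OF ij(1)] axis_topspace[OF ij(1), of 1] axis_topspace[OF ij(2), of 1]] ij
      by (simp only: lin axis_topspace)
    then show ?thesis by simp
  qed
  have diag: "ip (axis i 1) (axis i 1) = c" if i: "i < n" for i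
  proof (cases "i = 0")
    case False
    have 0: "0 < n" using n by simp
    let ?w = "signed_perm (\<lambda>k. if k = i then 0 else if k = 0 then i else k) (\<lambda>_. 1)"
    have "weyl_act n ?w (axis i 1) = axis 0 1"
      using i 0 by (subst weyl_act_signed_perm) (auto simp: axis_def)
    then show ?thesis
      using inv[OF swap_in_weyl_group[OF i 0 False] axis_topspace[OF i, of 1] axis_topspace[OF i, of 1]]
      by (simp add: c_def)
  qed (simp add: c_def)
  have expand: "ip x z = (\<Sum>i<n. x i * ip (axis i 1) z)" if x: "x \<in> ?E" and z: "z \<in> ?E" for x z
  proof -
    have "ip (\<lambda>i. if i < k then x i else 0) z = (\<Sum>i<k. x i * ip (axis i 1) z)" if "k \<le> n" for k
      using that
    proof (induction k)
      case 0
      have "(\<lambda>_. 0) \<in> ?E" by (simp add: topspace_Euclidean_space)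
      then show ?case using lin[of "\<lambda>_. 0" "\<lambda>_. 0" z 0 0] z by simp
    next
      case (Suc k)
      have "(\<lambda>i. if i < Suc k then x i else 0) = (\<lambda>i. 1 * (if i < k then x i else 0) + x k * axis k 1 i)"
        by (auto simp: axis_def less_Suc_eq)
      moreover have "(\<lambda>i. if i < k then x i else 0) \<in> ?E" using x by (auto simp: topspace_Euclidean_space)
      ultimately show ?case using Suc z by (simp only: lin axis_topspace Suc_le_eq) simp
    qed
    moreover have "(\<lambda>i. if i < n then x i else 0) = x" using x by (auto simp: topspace_Euclidean_space)
    ultimately show ?thesis by (metis le_refl)
  qed
  have gen: "ip x y = c * pairing n x y" if x: "x \<in> ?E" and y: "y \<in> ?E" for x y
  proof -
    have "ip (axis i 1) y = c * y i" if i: "i < n" for i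
    proof -
      have "ip (axis i 1) y = (\<Sum>j<n. y j * ip (axis j 1) (axis i 1))"
        using expand[OF y axis_topspace[OF i]] sym[OF axis_topspace[OF i] y] by simp
      also have "\<dots> = (\<Sum>j<n. if j = i then c * y i else 0)"
        by (rule sum.cong) (use orth diag i in auto)
      finally show ?thesis using i by simp
    qed
    then show ?thesis using expand[OF x y] by (simp add: pairing_def sum_distrib_left mult_ac)
  qed
  have "c > 0" unfolding c_def using n by (intro pos axis_topspace) (auto simp: axis_def fun_eq_iff)
  have E: "v \<in> ?E" if "v \<in> roots n" for v using that by (simp add: roots_def)
  have th: "B_theta \<in> roots n" using B_theta_root[OF n] by (simp add: roots_eq)
  have th2: "pairing n B_theta B_theta = 2" using pairing_theta[OF n, of B_theta] by (simp add: B_theta_def)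
  have "ip v v \<le> ip B_theta B_theta" if "v \<in> roots n" for v
    using B_roots_norm_le[of v n] that \<open>c > 0\<close> E[OF that] E[OF th] by (simp add: gen th2 roots_eq)
  then have "ip B_theta B_theta = 2" using ip th by (auto simp: is_basic_inner_product_def)
  then have "c = 1" using gen[OF E[OF th] E[OF th]] th2 by simp
  then show ?thesis using gen[OF x y] by simp
qed

theorem basic_ip_eq:
  assumes "n > 1" "x \<in> topspace (Euclidean_space n)" "y \<in> topspace (Euclidean_space n)"
  shows "basic_ip n x y = pairing n x y"
proof -
  have "is_basic_inner_product n (basic_ip n)"
    unfolding basic_ip_def by (rule someI[of "is_basic_inner_product n"]) (rule pairing_basic[OF assms(1)])
  then show ?thesis by (rule basic_inner_product_unique[OF assms(1) _ assms(2,3)])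
qed

subsection \<open>Highest root and alcove\<close>

definition simple_root :: "nat \<Rightarrow> nat \<Rightarrow> nat \<Rightarrow> real" where
  "simple_root n k = (\<lambda>j. if j = k then 1 else if j = Suc k \<and> Suc k < n then - 1 else 0)"

lemma simple_root_positive:
  assumes "k < n"
  shows "simple_root n k \<in> positive_roots n"
proof -
  have "{j. simple_root n k j \<noteq> 0} \<subseteq> {k, Suc k}" by (auto simp: simple_root_def split: if_splits)
  then have "card {j. simple_root n k j \<noteq> 0} \<le> card {k, Suc k}" by (intro card_mono) auto
  moreover have "simple_root n k k = 1" "\<forall>j<k. simple_root n k j = 0" by (auto simp: simple_root_def)
  moreover have "\<forall>j. simple_root n k j \<in> {- 1, 0, 1}" by (simp add: simple_root_def)
  moreover have "\<forall>j\<ge>n. simple_root n k j = 0" using assms by (simp add: simple_root_def)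
  moreover have "simple_root n k \<noteq> (\<lambda>_. 0)" by (auto simp: simple_root_def dest!: fun_cong[of _ _ k])
  ultimately show ?thesis using assms
    by (auto simp: positive_roots_def roots_eq B_roots_def topspace_Euclidean_space intro!: exI[of _ k])
qed

lemma positive_root_sums_add_multiple:
  assumes "x \<in> positive_root_sums n" "u \<in> positive_roots n"
  shows "(\<lambda>j. x j + real k * u j) \<in> positive_root_sums n"
proof (induction k)
  case (Suc k)
  have "(\<lambda>j. x j + real (Suc k) * u j) = (\<lambda>j. (x j + real k * u j) + u j)" by (auto simp: algebra_simps)
  then show ?case using positive_root_sums.add[OF Suc assms(2)] by simp
qed (use assms in simp)

text \<open>The coefficients of a vector with respect to the simple roots are its partial sums.\<close>

lemma partial_sums_imp_positive_root_sum:
  assumes x: "x \<in> topspace (Euclidean_space n)" and nat: "\<And>k. k \<le> n \<Longrightarrow> (\<Sum>i<k. x i) \<in> \<nat>"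
  shows "x \<in> positive_root_sums n"
proof -
  \<comment> \<open>Truncate x after k coordinates and correct the next entry so that the total is
    0. Raising k by one adds the new partial sum times the simple root k; at k = n no correction is
    left and the vector is x.\<close>
  have "(\<lambda>j. if j < k then x j else if j = k \<and> k < n then - (\<Sum>i<k. x i) else 0) \<in> positive_root_sums n"
    (is "?y k \<in> _") if "k \<le> n" for k
    using that
  proof (induction k)
    case 0
    have "?y 0 = (\<lambda>_. 0)" by auto
    then show ?case by (simp only: positive_root_sums.zero)
  next
    case (Suc k)
    obtain c where c: "(\<Sum>i<Suc k. x i) = real c" using nat[OF Suc(2)] by (auto elim: Nats_cases)
    have "?y (Suc k) = (\<lambda>j. ?y k j + real c * simple_root n k j)"
      using Suc(2) c by (auto simp: simple_root_def fun_eq_iff less_Suc_eq)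
    then show ?case using positive_root_sums_add_multiple[OF Suc(1) simple_root_positive[of k n], of c] Suc(2)
      by simp
  qed
  then have "?y n \<in> positive_root_sums n" by blast
  moreover have "?y n = x" using x by (auto simp: topspace_Euclidean_space)
  ultimately show ?thesis by simp
qed

text \<open>The partial sums of \<open>B_theta\<close> are min k 2. Those of a root are at most k,
  as entries are at most 1, and at most 2, as no more than two entries are nonzero.\<close>

lemma theta_minus_root:
  assumes n: "n > 1" and u: "u \<in> B_roots n"
  shows "(\<lambda>j. B_theta j - u j) \<in> positive_root_sums n"
proof (rule partial_sums_imp_positive_root_sum)
  show "(\<lambda>j. B_theta j - u j) \<in> topspace (Euclidean_space n)"
    using u n by (auto simp: topspace_Euclidean_space B_roots_def B_theta_def)
  fix k assume "k \<le> n"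
  have pm: "u j \<in> {- 1, 0, 1}" for j using u by (auto simp: B_roots_def)
  have le: "u j \<le> 1" for j using pm[of j] by auto
  have int: "u j \<in> \<int>" for j using pm[of j] by auto
  have S: "{j. u j \<noteq> 0} \<subseteq> {..<n}" using u by (auto simp: B_roots_def topspace_Euclidean_space not_le[symmetric])
  then have fin: "finite {j. u j \<noteq> 0}" by (rule finite_subset) simp
  have "(\<Sum>i<k. u i) \<le> (\<Sum>i<k. if u i \<noteq> 0 then 1 else 0)"
    by (rule sum_mono) (use le in auto)
  also have "\<dots> = card ({..<k} \<inter> {j. u j \<noteq> 0})" by (simp add: sum.If_cases)
  also have "\<dots> \<le> card {j. u j \<noteq> 0}" using fin by (simp add: card_mono)
  also have "real (card {j. u j \<noteq> 0}) \<le> 2" using u by (simp add: B_roots_def)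
  finally have 2: "(\<Sum>i<k. u i) \<le> 2" by simp
  have th: "(\<Sum>i<k. B_theta i) = min (real k) 2"
  proof -
    have "(\<Sum>i<k. B_theta i) = (\<Sum>i\<in>{..<k} \<inter> {i. i < 2}. 1)"
      by (simp add: B_theta_def sum.If_cases)
    also have "{..<k} \<inter> {i. i < 2} = {..<min k 2}" by auto
    finally show ?thesis by simp
  qed
  have "(\<Sum>i<k. u i) \<le> (\<Sum>i<k. 1)" by (rule sum_mono) (rule le)
  then have "0 \<le> (\<Sum>i<k. B_theta i - u i)" using 2 by (simp add: sum_subtractf th)
  moreover have "(\<Sum>i<k. B_theta i - u i) \<in> \<int>" by (intro Ints_sum Ints_diff int) (simp add: B_theta_def)
  ultimately show "(\<Sum>i<k. B_theta i - u i) \<in> \<nat>" by (simp add: Nats_altdef2)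
qed

text \<open>Lexicographic positivity is preserved by addition. Hence a vector and its negative can
  both be sums of positive roots only if it is 0, which makes the highest root unique.\<close>

lemma positive_root_sums_lex:
  assumes "x \<in> positive_root_sums n"
  shows "x = (\<lambda>_. 0) \<or> (\<exists>k. x k > 0 \<and> (\<forall>j<k. x j = 0))"
  using assms
proof (induction rule: positive_root_sums.induct)
  case (add x u)
  obtain l where l: "u l > 0" "\<forall>j<l. u j = 0" using add(2) by (auto simp: positive_roots_def)
  from add(3) show ?case
  proof
    assume "x = (\<lambda>_. 0)"
    then show ?thesis using l by auto
  next
    assume "\<exists>k. x k > 0 \<and> (\<forall>j<k. x j = 0)"
    then obtain k where k: "x k > 0" "\<forall>j<k. x j = 0" by blast
    have "x (min k l) + u (min k l) > 0" using k l by (cases k l rule: linorder_cases) auto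
    moreover have "\<forall>j<min k l. x j + u j = 0" using k l by simp
    ultimately show ?thesis by blast
  qed
qed simp

lemma highest_root_eq:
  assumes n: "n > 1"
  shows "highest_root n = B_theta"
  unfolding highest_root_def
proof (rule the_equality)
  show "B_theta \<in> roots n \<and> (\<forall>u\<in>roots n. (\<lambda>j. B_theta j - u j) \<in> positive_root_sums n)"
    using B_theta_root[OF n] theta_minus_root[OF n] by (simp add: roots_eq)
next
  fix h assume h: "h \<in> roots n \<and> (\<forall>u\<in>roots n. (\<lambda>j. h j - u j) \<in> positive_root_sums n)"
  then have "(\<lambda>j. h j - B_theta j) \<in> positive_root_sums n" "(\<lambda>j. B_theta j - h j) \<in> positive_root_sums n"
    using B_theta_root[OF n] theta_minus_root[OF n] by (simp_all add: roots_eq)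
  note this[THEN positive_root_sums_lex]
  then consider "(\<lambda>j. h j - B_theta j) = (\<lambda>_. 0)" | "(\<lambda>j. B_theta j - h j) = (\<lambda>_. 0)"
    | k l where "h k - B_theta k > 0" "\<forall>j<k. h j - B_theta j = 0" "B_theta l - h l > 0" "\<forall>j<l. B_theta j - h j = 0"
    by blast
  then show "h = B_theta"
  proof cases
    case 3
    then show ?thesis by (cases k l rule: linorder_cases) auto
  qed (simp_all add: fun_eq_iff)
qed

section \<open>Inequalities for the chamber and the alcove\<close>

lemma pairing_simple_root:
  assumes "k < n"
  shows "pairing n x (simple_root n k) = x k - (if Suc k < n then x (Suc k) else 0)"
proof -
  have "x j * simple_root n k j = (if j = k then x k else 0) + (if j = Suc k then (if Suc k < n then - x (Suc k) else 0) else 0)" for j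
    by (simp add: simple_root_def)
  then show ?thesis using assms by (simp add: pairing_def sum.distrib)
qed

text \<open>The simple roots give the inequalities. Conversely a positive root has leading entry 1
  at some k and at most one further entry \<plusminus>1 at some l > k, so its pairing with a
  decreasing nonnegative x is x k or x k \<plusminus> x l.\<close>

lemma weyl_chamber_eq:
  assumes n: "n > 1"
  shows "weyl_chamber n = {x \<in> topspace (Euclidean_space n).
    (\<forall>j. Suc j < n \<longrightarrow> x j \<ge> x (Suc j)) \<and> x (n - 1) \<ge> 0}"
proof (intro equalityI subsetI)
  fix x assume "x \<in> weyl_chamber n"
  then have x: "x \<in> topspace (Euclidean_space n)" and pos: "\<And>u. u \<in> positive_roots n \<Longrightarrow> pairing n x u \<ge> 0"
    by (auto simp: weyl_chamber_def basic_ip_eq[OF n] positive_roots_def roots_def)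
  have s: "x k - (if Suc k < n then x (Suc k) else 0) \<ge> 0" if "k < n" for k
    using pos[OF simple_root_positive[OF that]] pairing_simple_root[OF that] by simp
  have "x j \<ge> x (Suc j)" if "Suc j < n" for j using s[of j] that by simp
  moreover have "x (n - 1) \<ge> 0" using s[of "n - 1"] n by simp
  ultimately show "x \<in> {x \<in> topspace (Euclidean_space n). (\<forall>j. Suc j < n \<longrightarrow> x j \<ge> x (Suc j)) \<and> x (n - 1) \<ge> 0}"
    using x by simp
next
  fix x :: "nat \<Rightarrow> real" assume "x \<in> {x \<in> topspace (Euclidean_space n). (\<forall>j. Suc j < n \<longrightarrow> x j \<ge> x (Suc j)) \<and> x (n - 1) \<ge> 0}"
  then have x: "x \<in> topspace (Euclidean_space n)" and dec: "\<And>j. Suc j < n \<Longrightarrow> x j \<ge> x (Suc j)"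
    and last: "x (n - 1) \<ge> 0" by auto
  have mono: "x l \<le> x k" if "k \<le> l" "l < n" for k l
    using that
  proof (induction l rule: dec_induct)
    case (step l)
    then show ?case using dec[of l] by simp
  qed simp
  have nonneg: "x k \<ge> 0" if "k < n" for k using mono[of k "n - 1"] last that by fastforce
  have "pairing n x u \<ge> 0" if u: "u \<in> positive_roots n" for u
  proof -
    obtain k where k: "k < n" "u k > 0" "\<forall>j<k. u j = 0" using u by (auto simp: positive_roots_def)
    have uB: "u \<in> B_roots n" using u by (simp add: positive_roots_def roots_eq)
    have pm: "u j \<in> {- 1, 0, 1}" for j using uB by (auto simp: B_roots_def)
    have k1: "u k = 1" using pm[of k] k by auto
    let ?S = "{j. u j \<noteq> 0}"
    have S: "?S \<subseteq> {..<n}" using uB by (auto simp: B_roots_def topspace_Euclidean_space not_le[symmetric])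
    then have fin: "finite ?S" by (rule finite_subset) simp
    have "card ?S \<le> 2" using uB by (simp add: B_roots_def)
    then have "card (?S - {k}) \<le> 1" using k1 fin by simp
    then have "\<forall>a\<in>?S - {k}. \<forall>b\<in>?S - {k}. a = b"
      unfolding One_nat_def using card_le_Suc0_iff_eq[of "?S - {k}"] fin by blast
    then obtain l where l: "?S - {k} \<subseteq> {l}" by blast
    have eq: "pairing n x u = x k + (\<Sum>j\<in>?S - {k}. x j * u j)"
    proof -
      have "pairing n x u = (\<Sum>j\<in>?S. x j * u j)"
        unfolding pairing_def by (rule sum.mono_neutral_right) (use S in auto)
      then show ?thesis using fin k1 by (simp add: sum.remove[of ?S k])
    qed
    show ?thesis
    proof (cases "?S - {k} = {}")
      case True
      then show ?thesis using eq nonneg[OF k(1)] by (simp only: sum.empty)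
    next
      case False
      then have Sl: "?S - {k} = {l}" using l by blast
      then have ln: "l < n" "l \<noteq> k" "u l \<noteq> 0" using S by auto
      then have "k < l" using k(3) by (meson linorder_neqE_nat)
      then have "x l \<le> x k" using mono ln by simp
      moreover have "x l \<ge> 0" "u l = 1 \<or> u l = - 1" using nonneg ln pm[of l] by auto
      ultimately show ?thesis unfolding eq Sl by auto
    qed
  qed
  then show "x \<in> weyl_chamber n"
    using x by (auto simp: weyl_chamber_def basic_ip_eq[OF n] positive_roots_def roots_def)
qed

lemma alcove_eq:
  assumes n: "n > 1"
  shows "alcove n m = {x \<in> topspace (Euclidean_space n).
    (\<forall>j. Suc j < n \<longrightarrow> x j \<ge> x (Suc j)) \<and> x (n - 1) \<ge> 0 \<and> x 0 + x 1 \<le> real m}"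
proof -
  have "B_theta \<in> topspace (Euclidean_space n)" using B_theta_root[OF n] by (simp add: B_roots_def)
  then show ?thesis
    by (auto simp: alcove_def highest_root_eq[OF n] basic_ip_eq[OF n] pairing_theta[OF n] weyl_chamber_eq[OF n])
qed

text \<open>The line through y along axis k is continuous, so the parameters that stay in an open
  set around y form an open set around 0. Moving against a wall in this way makes a weak inequality
  strict.\<close>

lemma interior_perturb_axis:
  assumes y: "y \<in> Euclidean_space n interior_of A" and k: "k < n"
  obtains e where "e > 0" "(\<lambda>j. y j + axis k e j) \<in> A" "(\<lambda>j. y j + axis k (- e) j) \<in> A"
proof -
  obtain T where T: "openin (Euclidean_space n) T" "y \<in> T" "T \<subseteq> A"
    using y by (auto simp: interior_of_def)
  have yE: "y \<in> topspace (Euclidean_space n)" using T openin_subset by blast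
  define f where "f s = (\<lambda>i. if i < n then y i + axis k s i else 0)" for s
  have "continuous_on UNIV (\<lambda>s. y i + axis k s i)" for i
    by (cases "i = k") (auto simp: axis_def intro!: continuous_intros)
  then have "continuous_map euclideanreal (Euclidean_space n) f"
    unfolding f_def continuous_map_componentwise_Euclidean_space by simp
  then have "openin euclideanreal {s \<in> topspace euclideanreal. f s \<in> T}" using T(1) by (rule openin_continuous_map_preimage)
  then have op: "open {s. f s \<in> T}" by simp
  have f: "f s = (\<lambda>j. y j + axis k s j)" for s
    using yE k by (auto simp: f_def topspace_Euclidean_space axis_def)
  have "0 \<in> {s. f s \<in> T}" using T(2) by (simp add: f axis_def)
  then obtain e where e: "e > 0" "ball 0 e \<subseteq> {s. f s \<in> T}" using op open_contains_ball by blast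
  \<comment> \<open>The ball is open, so half its radius is used.\<close>
  have "e / 2 \<in> ball 0 e" "- (e / 2) \<in> ball 0 e" using e(1) by (auto simp: dist_real_def)
  then have "f (e / 2) \<in> T" "f (- (e / 2)) \<in> T" using e(2) by blast+
  then have "f (e / 2) \<in> A" "f (- (e / 2)) \<in> A" using T(3) by blast+
  then show ?thesis using that[of "e / 2"] e(1) unfolding f by simp
qed

text \<open>Lowering x j, lowering x (n - 1) and raising x 0 move against the three kinds of walls.
  Conversely, finitely many strict inequalities between coordinates are an open condition in the
  product topology.\<close>

lemma interior_alcove_eq:
  assumes n: "n > 1"
  shows "Euclidean_space n interior_of alcove n m = {x \<in> topspace (Euclidean_space n).
    (\<forall>j. Suc j < n \<longrightarrow> x j > x (Suc j)) \<and> x (n - 1) > 0 \<and> x 0 + x 1 < real m}" (is "_ = ?B")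
proof (intro equalityI subsetI)
  fix y assume y: "y \<in> Euclidean_space n interior_of alcove n m"
  have top: "y \<in> topspace (Euclidean_space n)"
    using y interior_of_subset_topspace[of "Euclidean_space n"] by blast
  have "y j > y (Suc j)" if j: "Suc j < n" for j
  proof -
    obtain e where "e > 0" "(\<lambda>i. y i + axis j (- e) i) \<in> alcove n m"
      using interior_perturb_axis[OF y, of j] j by auto
    then show ?thesis using j by (auto simp: alcove_eq[OF n] axis_def dest!: spec[of _ j])
  qed
  moreover have "y (n - 1) > 0"
  proof -
    obtain e where "e > 0" "(\<lambda>i. y i + axis (n - 1) (- e) i) \<in> alcove n m"
      using interior_perturb_axis[OF y, of "n - 1"] n by auto
    then show ?thesis by (auto simp: alcove_eq[OF n] axis_def)
  qed
  moreover have "y 0 + y 1 < real m"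
  proof -
    obtain e where "e > 0" "(\<lambda>i. y i + axis 0 e i) \<in> alcove n m"
      using interior_perturb_axis[OF y, of 0] n by auto
    then show ?thesis by (auto simp: alcove_eq[OF n] axis_def)
  qed
  ultimately show "y \<in> ?B" using top by simp
next
  have coord: "continuous_on UNIV (\<lambda>x :: nat \<Rightarrow> real. x i)" for i by simp
  define W where "W = (\<Inter>j\<in>{..<n - 1}. {x :: nat \<Rightarrow> real. x (Suc j) < x j}) \<inter> {x. 0 < x (n - 1)} \<inter> {x. x 0 + x 1 < real m}"
  have "open W" unfolding W_def
    by (intro open_Int open_INT finite_lessThan ballI open_Collect_less continuous_intros coord)
  then have "openin (powertop_real UNIV) W" by (simp add: euclidean_product_topology)
  moreover have "?B = W \<inter> {x. \<forall>i\<ge>n. x i = 0}"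
    using n by (auto simp: W_def topspace_Euclidean_space less_diff_conv)
  ultimately have "openin (Euclidean_space n) ?B"
    unfolding Euclidean_space_def openin_subtopology by blast
  moreover have "?B \<subseteq> alcove n m" by (auto simp: alcove_eq[OF n] less_imp_le)
  moreover fix y assume "y \<in> ?B"
  ultimately show "y \<in> Euclidean_space n interior_of alcove n m"
    by (auto simp: interior_of_def)
qed

theorem regular_weights_eq:
  assumes n: "n > 1"
  shows "regular_weights n m = {a. (\<forall>j\<ge>n. a j = 0) \<and> ((\<forall>j<n. a j \<in> \<int>) \<or> (\<forall>j<n. a j - 1 / 2 \<in> \<int>)) \<and>
    (\<forall>j. Suc j < n \<longrightarrow> a j > a (Suc j)) \<and> a (n - 1) > 0 \<and> a 0 + a 1 < real m}"
  using n by (auto simp: regular_weights_def weight_lattice_eq interior_alcove_eq topspace_Euclidean_space)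

subsection \<open>Counting\<close>

definition prime_power_denom :: "nat \<Rightarrow> real \<Rightarrow> bool" where
  "prime_power_denom p y \<longleftrightarrow> (\<exists>q::rat. real_of_rat q = y \<and> (\<exists>k::nat. snd (quotient_of q) = int p ^ k))"

text \<open>Reducing the fraction replaces the denominator by a divisor, and a positive divisor of a
  prime power is again a power of that prime.\<close>

lemma prime_power_denom_iff:
  assumes p: "prime p"
  shows "prime_power_denom p y \<longleftrightarrow> (\<exists>z k. y = of_int z / of_int (int p ^ k))"
proof
  assume "prime_power_denom p y"
  then obtain q k where q: "real_of_rat q = y" "snd (quotient_of q) = int p ^ k" by (auto simp: prime_power_denom_def)
  obtain z where "quotient_of q = (z, int p ^ k)" using q by (metis prod.collapse)
  then have "q = of_int z / of_int (int p ^ k)" by (rule quotient_of_div)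
  then have "y = of_int z / of_int (int p ^ k)" using q by (simp only: of_rat_divide of_rat_of_int_eq flip: q(1))
  then show "\<exists>z k. y = of_int z / of_int (int p ^ k)" by blast
next
  assume "\<exists>z k. y = of_int z / of_int (int p ^ k)"
  then obtain z k where y: "y = of_int z / of_int (int p ^ k)" by blast
  have pos: "int p ^ k > 0" using prime_gt_0_nat[OF p] by simp
  let ?q = "Fract z (int p ^ k)"
  have "snd (quotient_of ?q) = int p ^ k div gcd z (int p ^ k)"
    using pos by (simp add: quotient_of_Fract Rat.normalize_def Let_def)
  then have dvd: "snd (quotient_of ?q) dvd int p ^ k" by (metis dvd_div_mult_self dvd_triv_left gcd_dvd2)
  have "prime (int p)" using p by simp
  then obtain j where "normalize (snd (quotient_of ?q)) = int p ^ j" using divides_primepow[OF _ dvd] by metis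
  then have "snd (quotient_of ?q) = int p ^ j" using quotient_of_denom_pos'[of ?q] by simp
  moreover have "real_of_rat ?q = y" using pos by (simp only: Fract_of_int_quotient of_rat_divide of_rat_of_int_eq y)
  ultimately show "prime_power_denom p y" unfolding prime_power_denom_def by blast
qed

text \<open>Clearing denominators gives c * p^k = (e * m') * z * p^i; d divides the right side and
  is coprime to p. The applications take e = 2, the denominator of half-integers, with d = m' for p
  = 2 and d = 2 * m' for odd p.\<close>

lemma prime_power_denom_dvd:
  fixes c d e :: int
  assumes p: "prime p" and m: "m = p ^ i * m'" "m > 0" and cop: "coprime d (int p)"
    and e: "e > 0" "d dvd e * int m'"
    and den: "prime_power_denom p (of_int c / (of_int e * real m))"
  shows "d dvd c"
proof -
  obtain z k where "of_int c / (of_int e * real m) = of_int z / of_int (int p ^ k)"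
    using den by (auto simp: prime_power_denom_iff[OF p])
  then have "real_of_int c * of_int (int p ^ k) = of_int z * (of_int e * real m)"
    using m(2) e(1) prime_gt_0_nat[OF p] by (simp add: field_simps)
  then have "real_of_int (c * int p ^ k) = of_int (z * (e * int m))" by simp
  then have "c * int p ^ k = z * (e * int m)" by (simp only: of_int_eq_iff)
  also have "\<dots> = (e * int m') * (z * int p ^ i)" using m(1) by simp
  finally have "d dvd c * int p ^ k" using e(2) by simp
  moreover have "coprime d (int p ^ k)" using cop by simp
  ultimately show ?thesis by (simp add: coprime_dvd_mult_left_iff)
qed

lemma half_int_iff: "(\<exists>c::int. 2 * x = of_int c) \<longleftrightarrow> x \<in> \<int> \<or> x - 1 / 2 \<in> \<int>" for x :: real
proof
  assume "\<exists>c::int. 2 * x = of_int c"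
  then obtain c where c: "2 * x = of_int c" by blast
  show "x \<in> \<int> \<or> x - 1 / 2 \<in> \<int>"
  proof (cases "even c")
    case True
    then have "x \<in> \<int>" using c by (auto elim!: evenE)
    then show ?thesis by blast
  next
    case False
    then have "x - 1 / 2 \<in> \<int>" using c by (auto elim!: oddE simp: field_simps)
    then show ?thesis by blast
  qed
next
  assume "x \<in> \<int> \<or> x - 1 / 2 \<in> \<int>"
  then show "\<exists>c::int. 2 * x = of_int c"
  proof
    assume "x \<in> \<int>"
    then obtain z where "x = of_int z" by (auto elim: Ints_cases)
    then show ?thesis by (intro exI[of _ "2 * z"]) simp
  next
    assume "x - 1 / 2 \<in> \<int>"
    then obtain z where "x - 1 / 2 = of_int z" by (auto elim: Ints_cases)
    then show ?thesis by (intro exI[of _ "2 * z + 1"]) simp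
  qed
qed

section \<open>The bijection by scaling with m'\<close>

lemma N_B_eq:
  assumes n: "n > 1"
  shows "N_B n m p = card {a \<in> regular_weights n m. \<forall>w\<in>weight_lattice n. prime_power_denom p (pairing n w a / real m)}"
proof -
  have "basic_ip n w a = pairing n w a" if "a \<in> regular_weights n m" "w \<in> weight_lattice n" for a w
    using that by (intro basic_ip_eq n) (auto simp: regular_weights_def weight_lattice_def)
  then have "{a \<in> regular_weights n m. \<forall>w\<in>weight_lattice n. prime_power_denom p (pairing n w a / real m)} =
     {a \<in> regular_weights n m. \<forall>w\<in>weight_lattice n.
     \<exists>q::rat. real_of_rat q = basic_ip n w a / real m \<and> (\<exists>k::nat. snd (quotient_of q) = int p ^ k)}"
    unfolding prime_power_denom_def by auto
  then show ?thesis by (simp add: N_B_def)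
qed

lemma axis_weight: "j < n \<Longrightarrow> axis j 1 \<in> weight_lattice n"
  by (auto simp: weight_lattice_eq axis_def)

lemma weight_double_int: "w \<in> weight_lattice n \<Longrightarrow> j < n \<Longrightarrow> \<exists>c::int. 2 * w j = of_int c"
  using half_int_iff by (auto simp: weight_lattice_eq)

lemma pairing_commute: "pairing n x y = pairing n y x"
  by (simp add: pairing_def mult.commute)

lemma weight_scale_odd:
  assumes "odd k" and l: "(\<forall>j<n. l j \<in> \<int>) \<or> (\<forall>j<n. l j - 1 / 2 \<in> \<int>)"
  shows "(\<forall>j<n. real k * l j \<in> \<int>) \<or> (\<forall>j<n. real k * l j - 1 / 2 \<in> \<int>)"
proof -
  obtain r where r: "k = 2 * r + 1" using assms(1) by (auto elim: oddE)
  have "real k * x - 1 / 2 \<in> \<int>" if "x - 1 / 2 \<in> \<int>" for x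
  proof -
    have "real k * x - 1 / 2 = real k * (x - 1 / 2) + real r" by (simp add: r field_simps)
    then show ?thesis using that by simp
  qed
  then show ?thesis using l by auto
qed

text \<open>The denominator condition holds for every scaled tuple, as the pairing of two weights is
  a quarter integer. In the other direction m' is odd, so division by it preserves the distinction
  between integers and half-integers.\<close>

lemma N_B_two:
  assumes n: "n > 1" and m: "m > 0" "m = 2 ^ i * m'" and odd: "odd m'"
  shows "N_B n m 2 = card {b :: nat \<Rightarrow> real. (\<forall>j\<ge>n. b j = 0) \<and>
              ((\<forall>j<n. b j \<in> \<int>) \<or> (\<forall>j<n. b j - 1 / 2 \<in> \<int>)) \<and>
              (\<forall>j. Suc j < n \<longrightarrow> b j > b (Suc j)) \<and> b (n - 1) > 0 \<and>
              real (2 ^ i) > b 0 + b 1}" (is "_ = card ?S")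
proof -
  let ?f = "\<lambda>b j. real m' * b j"
  let ?A = "{a \<in> regular_weights n m. \<forall>w\<in>weight_lattice n. prime_power_denom 2 (pairing n w a / real m)}"
  have m'0: "m' > 0" using odd by (auto intro: Nat.gr0I)
  have f_in: "?f b \<in> ?A" if b: "b \<in> ?S" for b
  proof -
    have "?f b 0 + ?f b 1 = real m' * (b 0 + b 1)" by (simp add: algebra_simps)
    also have "\<dots> < real m' * real (2 ^ i)" using b m'0 by (intro mult_strict_left_mono) auto
    finally have "?f b 0 + ?f b 1 < real m" using m(2) by (simp add: mult.commute)
    then have "?f b \<in> regular_weights n m"
      unfolding regular_weights_eq[OF n] using b m'0 weight_scale_odd[OF odd, of n b] by simp
    moreover have "prime_power_denom 2 (pairing n w (?f b) / real m)" if w: "w \<in> weight_lattice n" for w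
    proof -
      have bw: "b \<in> weight_lattice n" using b n by (simp add: weight_lattice_eq)
      have "\<exists>c. \<forall>j<n. 2 * w j = of_int (c j)" using weight_double_int[OF w] by metis
      then obtain c :: "nat \<Rightarrow> int" where c: "\<And>j. j < n \<Longrightarrow> 2 * w j = of_int (c j)" by blast
      have "\<exists>d. \<forall>j<n. 2 * b j = of_int (d j)" using weight_double_int[OF bw] by metis
      then obtain d :: "nat \<Rightarrow> int" where d: "\<And>j. j < n \<Longrightarrow> 2 * b j = of_int (d j)" by blast
      \<comment> \<open>The doubled entries of w and b are integers, so the denominator divides 2 ^
        (i + 2).\<close>
      have "4 * pairing n w b = (\<Sum>j<n. (2 * w j) * (2 * b j))"
        by (simp add: pairing_def sum_distrib_left mult_ac)
      also have "\<dots> = of_int (\<Sum>j<n. c j * d j)" by (simp add: c d)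
      finally have 4: "4 * pairing n w b = of_int (\<Sum>j<n. c j * d j)" .
      have "pairing n w (?f b) / real m = pairing n w b / 2 ^ i"
        using m'0 by (simp add: pairing_def m(2) mult_ac flip: sum_distrib_left)
      also have "\<dots> = of_int (\<Sum>j<n. c j * d j) / of_int (int 2 ^ (i + 2))"
        unfolding 4[symmetric] by (simp add: power_add)
      finally show ?thesis using prime_power_denom_iff[OF two_is_prime_nat] by blast
    qed
    ultimately show ?thesis by blast
  qed
  have in_f: "a \<in> ?f ` ?S" if a: "a \<in> ?A" for a
  proof (rule image_eqI)
    let ?b = "\<lambda>j. a j / real m'"
    show "a = ?f ?b" using m'0 by auto
    have reg: "a \<in> regular_weights n m" using a by simp
    note reg' = reg[unfolded regular_weights_eq[OF n], simplified]
    have aw: "a \<in> weight_lattice n" using reg by (simp add: regular_weights_def)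
    have cd: "\<exists>c d::int. 2 * a j = of_int c \<and> c = int m' * d" if j: "j < n" for j
    proof -
      obtain c :: int where c: "2 * a j = of_int c" using weight_double_int[OF aw j] by blast
      have "prime_power_denom 2 (pairing n (axis j 1) a / real m)" using a axis_weight[OF j] by blast
      then have "prime_power_denom 2 (a j / real m)" unfolding pairing_commute[of n "axis j 1"] pairing_axis[OF j] by simp
      moreover have "a j / real m = of_int c / (of_int 2 * real m)" unfolding c[symmetric] by simp
      ultimately have "prime_power_denom 2 (of_int c / (of_int 2 * real m))" by simp
      then have "int m' dvd c"
        by (rule prime_power_denom_dvd[OF two_is_prime_nat m(2,1), rotated 3]) (use odd in auto)
      then show ?thesis using c by (auto elim: dvdE)
    qed
    have int: "?b j \<in> \<int>" if j: "j < n" "a j \<in> \<int>" for j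
    proof -
      obtain d :: int where d: "2 * a j = of_int (int m' * d)" using cd[OF j(1)] by blast
      obtain z where "a j = of_int z" using j(2) by (auto elim: Ints_cases)
      then have "real_of_int (int m' * d) = of_int (2 * z)" using d by simp
      then have "int m' * d = 2 * z" by (simp only: of_int_eq_iff)
      then have "even d" using odd by (metis dvd_triv_left even_mult_iff even_of_nat)
      then obtain e where "d = 2 * e" by blast
      then have "?b j = of_int e" using d m'0 by (simp add: field_simps)
      then show ?thesis by simp
    qed
    have half: "?b j - 1 / 2 \<in> \<int>" if j: "j < n" "a j - 1 / 2 \<in> \<int>" for j
    proof -
      obtain d :: int where d: "2 * a j = of_int (int m' * d)" using cd[OF j(1)] by blast
      obtain z where "a j - 1 / 2 = of_int z" using j(2) by (auto elim: Ints_cases)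
      then have "real_of_int (int m' * d) = of_int (2 * z + 1)" using d by (simp add: field_simps)
      then have "int m' * d = 2 * z + 1" by (simp only: of_int_eq_iff)
      then have "\<not> even d" by (metis dvd_mult odd_two_times_div_two_succ dvd_triv_left even_plus_one_iff)
      then obtain e where "d = 2 * e + 1" by (blast elim: oddE)
      then have "?b j - 1 / 2 = of_int e" using d m'0 by (simp add: field_simps)
      then show ?thesis by simp
    qed
    have "a 0 + a 1 < real m' * 2 ^ i" using reg' m(2) by (simp add: mult.commute)
    then have "a 0 / real m' + a 1 / real m' < 2 ^ i"
      using m'0 by (simp add: add_divide_distrib[symmetric] divide_less_eq mult.commute)
    then show "?b \<in> ?S" using reg' int half m'0 by (auto simp: divide_strict_right_mono)
  qed
  have "?A = ?f ` ?S"
  proof (rule equalityI)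
    show "?A \<subseteq> ?f ` ?S" by (rule subsetI) (rule in_f)
    show "?f ` ?S \<subseteq> ?A" by (rule image_subsetI) (rule f_in)
  qed
  moreover have "inj_on ?f ?S" using m'0 by (auto simp: inj_on_def fun_eq_iff)
  ultimately show ?thesis using N_B_eq[OF n] by (simp add: card_image)
qed

lemma N_B_odd:
  assumes n: "n > 1" and m: "m > 0" "m = p ^ i * m'" and p: "prime p" "p > 2" "\<not> p dvd m'"
  shows "N_B n m p = card {b :: nat \<Rightarrow> int. (\<forall>j\<ge>n. b j = 0) \<and>
              (\<forall>j. Suc j < n \<longrightarrow> b j > b (Suc j)) \<and> b (n - 1) > 0 \<and>
              int (p ^ i) > b 0 + b 1 \<and>
              2 dvd (\<Sum>j<n. b j)}" (is "_ = card ?S")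
proof -
  let ?f = "\<lambda>(b :: nat \<Rightarrow> int) j. real m' * of_int (b j)"
  let ?A = "{a \<in> regular_weights n m. \<forall>w\<in>weight_lattice n. prime_power_denom p (pairing n w a / real m)}"
  have m'0: "m' > 0" using m by (auto intro: Nat.gr0I)
  have p_odd: "odd p" using p by (simp add: prime_odd_nat)
  have f_in: "?f b \<in> ?A" if b: "b \<in> ?S" for b
  proof -
    have "?f b 0 + ?f b 1 = real m' * of_int (b 0 + b 1)" by (simp add: algebra_simps)
    also have "\<dots> < real m' * of_int (int (p ^ i))"
      using b m'0 by (intro mult_strict_left_mono) (simp_all only: of_int_less_iff mem_Collect_eq of_nat_0_less_iff)
    finally have "?f b 0 + ?f b 1 < real m" using m(2) by (simp add: mult.commute)
    then have "?f b \<in> regular_weights n m"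
      unfolding regular_weights_eq[OF n] using b m'0 by simp
    moreover have "prime_power_denom p (pairing n w (?f b) / real m)" if w: "w \<in> weight_lattice n" for w
    proof -
      obtain s where s: "(\<Sum>j<n. b j) = 2 * s" using b by auto
      have "pairing n w (\<lambda>j. of_int (b j)) \<in> \<int>"
      proof -
        consider "\<forall>j<n. w j \<in> \<int>" | "\<forall>j<n. w j - 1 / 2 \<in> \<int>" using w n by (auto simp: weight_lattice_eq)
        then show ?thesis
        proof cases
          case 1
          then show ?thesis unfolding pairing_def by (intro Ints_sum Ints_mult) auto
        next
          case 2
          \<comment> \<open>Splitting 1 / 2 off each entry of w leaves an integer plus half the
            coordinate sum of b, which is even.\<close>
          have "pairing n w (\<lambda>j. of_int (b j)) = (\<Sum>j<n. (w j - 1 / 2) * of_int (b j)) + of_int (\<Sum>j<n. b j) / 2"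
            by (simp add: pairing_def sum_divide_distrib sum.distrib[symmetric] algebra_simps)
          also have "\<dots> = (\<Sum>j<n. (w j - 1 / 2) * of_int (b j)) + of_int s" unfolding s by simp
          also have "\<dots> \<in> \<int>" using 2 by (intro Ints_add Ints_sum Ints_mult) auto
          finally show ?thesis .
        qed
      qed
      then obtain z where z: "pairing n w (\<lambda>j. of_int (b j)) = of_int z" by (auto elim: Ints_cases)
      have "pairing n w (?f b) / real m = pairing n w (\<lambda>j. of_int (b j)) / of_int (int p ^ i)"
        using m'0 by (simp add: pairing_def m(2) mult_ac flip: sum_distrib_left)
      then show ?thesis unfolding z using prime_power_denom_iff[OF p(1)] by blast
    qed
    ultimately show ?thesis by blast
  qed
  have in_f: "a \<in> ?f ` ?S" if a: "a \<in> ?A" for a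
  proof -
    have reg: "a \<in> regular_weights n m" using a by simp
    note reg' = reg[unfolded regular_weights_eq[OF n], simplified]
    have aw: "a \<in> weight_lattice n" using reg by (simp add: regular_weights_def)
    have cop: "coprime (2 * int m') (int p)"
    proof -
      have "coprime p m'" using p by (simp add: prime_imp_coprime)
      moreover have "coprime 2 p" using p_odd by simp
      ultimately have "coprime (2 * m') p" by (simp add: ac_simps)
      then have "coprime (int (2 * m')) (int p)" by (simp only: coprime_int_iff)
      then show ?thesis by simp
    qed
    have "\<exists>b. a j = real m' * of_int b" if j: "j < n" for j
    proof -
      obtain c :: int where c: "2 * a j = of_int c" using weight_double_int[OF aw j] by blast
      have "prime_power_denom p (pairing n (axis j 1) a / real m)" using a axis_weight[OF j] by blast
      then have "prime_power_denom p (a j / real m)" unfolding pairing_commute[of n "axis j 1"] pairing_axis[OF j] by simp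
      moreover have "a j / real m = of_int c / (of_int 2 * real m)" unfolding c[symmetric] by simp
      ultimately have "prime_power_denom p (of_int c / (of_int 2 * real m))" by simp
      \<comment> \<open>Since p is odd, the 2 in the denominator has to be cleared as well, and this
        excludes half-integral a.\<close>
      then have "2 * int m' dvd c"
        by (rule prime_power_denom_dvd[OF p(1) m(2,1) cop, rotated 2]) auto
      then obtain d where "c = 2 * int m' * d" by blast
      then have "a j = real m' * of_int d" using c by simp
      then show ?thesis by blast
    qed
    then obtain b0 where b0: "\<And>j. j < n \<Longrightarrow> a j = real m' * of_int (b0 j)" by metis
    define b where "b j = (if j < n then b0 j else 0)" for j
    have ab: "a = ?f b" using b0 reg' by (auto simp: b_def fun_eq_iff not_less)
    have "\<forall>j. Suc j < n \<longrightarrow> b j > b (Suc j)" "b (n - 1) > 0"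
      using reg' m'0 unfolding ab by (simp_all add: zero_less_mult_iff)
    moreover have "b 0 + b 1 < int (p ^ i)"
    proof -
      have "real m' * of_int (b 0 + b 1) < real m' * of_int (int (p ^ i))"
        using reg' m(2) unfolding ab by (simp add: algebra_simps)
      then show ?thesis using m'0 by (simp only: mult_less_cancel_left_pos of_nat_0_less_iff of_int_less_iff)
    qed
    moreover have "2 dvd (\<Sum>j<n. b j)"
    proof -
      \<comment> \<open>The weight with all entries 1 / 2 pairs with a to m' / 2 times the
        coordinate sum of b, so clearing the 2 makes that sum even.\<close>
      let ?h = "\<lambda>j. if j < n then 1 / 2 else 0 :: real"
      have "?h \<in> weight_lattice n" using n by (simp add: weight_lattice_eq)
      then have "prime_power_denom p (pairing n ?h a / real m)" using a by blast
      moreover have "pairing n ?h a / real m = of_int (int m' * (\<Sum>j<n. b j)) / (of_int 2 * real m)"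
        unfolding ab by (simp add: pairing_def sum_divide_distrib sum_distrib_left)
      ultimately have "prime_power_denom p (of_int (int m' * (\<Sum>j<n. b j)) / (of_int 2 * real m))" by simp
      then have "2 * int m' dvd int m' * (\<Sum>j<n. b j)"
        by (rule prime_power_denom_dvd[OF p(1) m(2,1) cop, rotated 2]) auto
      then show ?thesis using m'0 by (simp add: mult.commute)
    qed
    ultimately have "b \<in> ?S" by (simp add: b_def)
    then show ?thesis using ab by blast
  qed
  have "?A = ?f ` ?S"
  proof (rule equalityI)
    show "?A \<subseteq> ?f ` ?S" by (rule subsetI) (rule in_f)
    show "?f ` ?S \<subseteq> ?A" by (rule image_subsetI) (rule f_in)
  qed
  moreover have "inj_on ?f ?S" using m'0 by (auto simp: inj_on_def fun_eq_iff)
  ultimately show ?thesis using N_B_eq[OF n] by (simp add: card_image)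
qed

theorem mainTheorem3:
  fixes n m m' p i :: nat
  assumes "n > 1" and "m > 0" and "prime p"
    and "m = p ^ i * m'" and "\<not> p dvd m'"
  shows "(p = 2 \<longrightarrow> N_B n m p =
            card {b :: nat \<Rightarrow> real. (\<forall>j\<ge>n. b j = 0) \<and>
              ((\<forall>j<n. b j \<in> \<int>) \<or> (\<forall>j<n. b j - 1 / 2 \<in> \<int>)) \<and>
              (\<forall>j. Suc j < n \<longrightarrow> b j > b (Suc j)) \<and> b (n - 1) > 0 \<and>
              real (p ^ i) > b 0 + b 1})
       \<and> (p > 2 \<longrightarrow> N_B n m p =
            card {b :: nat \<Rightarrow> int. (\<forall>j\<ge>n. b j = 0) \<and>
              (\<forall>j. Suc j < n \<longrightarrow> b j > b (Suc j)) \<and> b (n - 1) > 0 \<and>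
              int (p ^ i) > b 0 + b 1 \<and>
              2 dvd (\<Sum>j<n. b j)})"
proof (intro conjI impI)
  assume "p = 2"
  then show "N_B n m p =
            card {b :: nat \<Rightarrow> real. (\<forall>j\<ge>n. b j = 0) \<and>
              ((\<forall>j<n. b j \<in> \<int>) \<or> (\<forall>j<n. b j - 1 / 2 \<in> \<int>)) \<and>
              (\<forall>j. Suc j < n \<longrightarrow> b j > b (Suc j)) \<and> b (n - 1) > 0 \<and>
              real (p ^ i) > b 0 + b 1}"
    using N_B_two[of n m i m'] assms by blast
qed (rule N_B_odd[OF assms(1,2,4,3) _ assms(5)])

end
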